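(* Let $g\in\mathcal{S}'(\mathbb{R})$ be supported on $[0,\infty)$ and let $a,b$ be constants. Suppose that $$\mathcal{L}\{g;y\}=a+b\log\left(\frac{1}{y}\right)+o(1),\qquad y\to0^+,$$ and that the Tauberian hypothesis $$g(\lambda x)-b\log\lambda\,\frac{\delta(x)}{\lambda}=O\left(\frac{1}{\lambda}\right),\qquad\lambda\to\infty,\ \text{in }\mathcal{S}'(\mathbb{R}),$$ holds. Then, as $\lambda\to\infty$ in $\mathcal{S}'(\mathbb{R})$, $$g(\lambda x)=(a+b\gamma)\frac{\delta(x)}{\lambda}+b\frac{\log\lambda}{\lambda}\delta(x)+\frac{b}{\lambda}\operatorname{Pf}\left(\frac{H(x)}{x}\right)+o\left(\frac{1}{\lambda}\right),$$ where $\gamma$ is Euler's constant.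
   Context: $\delta$ is the Dirac delta and $H$ the Heaviside function. $\langle \operatorname{Pf}(H(x)/x),\phi\rangle=\int_0^1\frac{\phi(x)-\phi(0)}{x}\,dx+\int_1^\infty\frac{\phi(x)}{x}\,dx$. For a distribution $g$, $g(\lambda x)$ is $\phi\mapsto \lambda^{-1}\langle g(x),\phi(x/\lambda)\rangle$. A relation $F_\lambda=O(c(\lambda))$ (resp. with $o$) in $\mathcal{S}'(\mathbb{R})$ means $\langle F_\lambda,\phi\rangle=O(c(\lambda))$ (resp. $o$) for every $\phi\in\mathcal{S}(\mathbb{R})$; asymptotic expansions in $\mathcal{S}'(\mathbb{R})$ are understood likewise after pairing with test functions. For $g\in\mathcal{S}'(\mathbb{R})$ supported in $[0,\infty)$, $\mathcal{L}\{g;y\}=\langle g(x),e^{-yx}\rangle$, $y>0$. *)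

theory Defs
  imports "HOL-Analysis.Analysis" "HOL-Library.Landau_Symbols"
begin

fun nderiv :: "nat \<Rightarrow> (real \<Rightarrow> complex) \<Rightarrow> real \<Rightarrow> complex" where
  "nderiv 0 f = f"
| "nderiv (Suc n) f = (\<lambda>x. vector_derivative (nderiv n f) (at x))"

definition smooth_fun :: "(real \<Rightarrow> complex) \<Rightarrow> bool" where
  "smooth_fun f \<longleftrightarrow> (\<forall>n x. nderiv n f differentiable (at x))"

definition schwartz :: "(real \<Rightarrow> complex) \<Rightarrow> bool" where
  "schwartz f \<longleftrightarrow> smooth_fun f \<and>
     (\<forall>j k. \<exists>C. \<forall>x. \<bar>x\<bar> ^ j * norm (nderiv k f x) \<le> C)"

definition schwartz_seminorm :: "nat \<Rightarrow> nat \<Rightarrow> (real \<Rightarrow> complex) \<Rightarrow> real" where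
  "schwartz_seminorm j k f = (SUP x. \<bar>x\<bar> ^ j * norm (nderiv k f x))"

text \<open>Tempered distributions: continuous linear functionals on S(R) (continuity
  expressed by the standard bound through finitely many Schwartz seminorms).\<close>
definition tempered :: "((real \<Rightarrow> complex) \<Rightarrow> complex) \<Rightarrow> bool" where
  "tempered T \<longleftrightarrow>
     (\<forall>\<phi> \<psi>. schwartz \<phi> \<longrightarrow> schwartz \<psi> \<longrightarrow> T (\<lambda>x. \<phi> x + \<psi> x) = T \<phi> + T \<psi>) \<and>
     (\<forall>c \<phi>. schwartz \<phi> \<longrightarrow> T (\<lambda>x. c * \<phi> x) = c * T \<phi>) \<and>
     (\<exists>C N. \<forall>\<phi>. schwartz \<phi> \<longrightarrow>
        norm (T \<phi>) \<le> C * (\<Sum>j\<le>N. \<Sum>k\<le>N. schwartz_seminorm j k \<phi>))"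

definition supported_nonneg :: "((real \<Rightarrow> complex) \<Rightarrow> complex) \<Rightarrow> bool" where
  "supported_nonneg T \<longleftrightarrow>
     (\<forall>\<phi>. schwartz \<phi> \<longrightarrow> closure {x. \<phi> x \<noteq> 0} \<inter> {0..} = {} \<longrightarrow> T \<phi> = 0)"

text \<open>Cut-offs used to give meaning to \<langle>g(x), e^{-yx}\<rangle>: smooth, equal to 1 on a
  neighbourhood of [0,\<infinity>), and 0 near -\<infinity>.\<close>
definition cutoff :: "(real \<Rightarrow> complex) \<Rightarrow> bool" where
  "cutoff \<eta> \<longleftrightarrow> smooth_fun \<eta> \<and> (\<exists>\<epsilon>>0. \<forall>x\<ge>-\<epsilon>. \<eta> x = 1) \<and> (\<exists>c. \<forall>x\<le>c. \<eta> x = 0)"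

definition laplace :: "((real \<Rightarrow> complex) \<Rightarrow> complex) \<Rightarrow> real \<Rightarrow> complex" where
  "laplace T y = (THE v. \<forall>\<eta>. cutoff \<eta> \<longrightarrow> T (\<lambda>x. \<eta> x * complex_of_real (exp (- y * x))) = v)"

definition dilate :: "((real \<Rightarrow> complex) \<Rightarrow> complex) \<Rightarrow> real \<Rightarrow> (real \<Rightarrow> complex) \<Rightarrow> complex" where
  "dilate T l \<phi> = complex_of_real (1 / l) * T (\<lambda>x. \<phi> (x / l))"

definition pf_H_over_x :: "(real \<Rightarrow> complex) \<Rightarrow> complex" where
  "pf_H_over_x \<phi> = (LBINT x=0..1. (\<phi> x - \<phi> 0) / complex_of_real x)
                   + (LBINT x=1..\<infinity>. \<phi> x / complex_of_real x)"

end

theory Submission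
  imports Defs "HOL-Computational_Algebra.Polynomial"
begin

text \<open>
  Let \<open>T\<^sub>\<lambda> \<phi>\<close> be \<open>\<lambda>\<close> times the difference of the two sides of the claimed expansion, paired with \<open>\<phi>\<close>.
  The hypothesis on the Laplace transform says that \<open>T\<^sub>\<lambda>\<close> tends to 0 on every exponential \<open>exp (- t x)\<close>
  with \<open>t > 0\<close>, because the finite part of \<open>H(x)/x\<close> takes the value \<open>- \<gamma> - ln t\<close> there. The Tauberian
  hypothesis says that \<open>T\<^sub>\<lambda>\<close> is pointwise bounded, hence equicontinuous along any sequence
  \<open>\<lambda>\<^sub>n \<rightarrow> \<infinity>\<close> by the uniform boundedness principle in the Schwartz space. Since \<open>T\<^sub>\<lambda>\<close> only sees
  \<open>[0, \<infinity>)\<close>, it suffices that linear combinations of these exponentials are dense in every weighted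
  \<open>C\<^sup>N\<close> norm on \<open>[-1, \<infinity>)\<close>: after damping \<open>\<phi>\<close> by \<open>exp (- \<delta> x)\<close>, Weierstrass' theorem in the variable
  \<open>exp (- \<delta> x / 2)\<close> approximates the N-th derivative, and the lower derivatives follow by integrating
  from infinity.
\<close>

section \<open>Iterated derivatives\<close>

text \<open>Equicontinuity is available only along a sequence: each test function has its own
  threshold beyond which \<open>T l \<phi>\<close> is bounded, and a sequence tending to infinity
  has only finitely many terms below any threshold.

  Exponentials are not Schwartz functions, since they grow at -\<infinity>. Every pairing therefore
  goes through a cutoff that vanishes left of -1, and approximation errors need control only on [-1,
  \<infinity>).

  A polynomial in s = exp(-r x) is admissible only without constant term. So one factor s has to be
  divided out before Weierstrass applies, and the quotient must still be continuous at s = 0. A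
  Schwartz function may decay more slowly than any exponential; damping by exp(-2 r x) = s^2
  supplies one s for the division and one for the continuity. The s that is multiplied back also
  absorbs the weights |x|^j.

  The constant a + b \<gamma> is forced: on exp(-t x), \<lambda> g(\<lambda> x) gives a + b ln
  \<lambda> - b ln t + o(1), while the finite part contributes b (-\<gamma> - ln t), so the
  coefficient of \<delta> has to make up b \<gamma>.\<close>

lemma nderivI:
  assumes "D 0 = f" and "\<And>n x. (D n has_vector_derivative D (Suc n) x) (at x)"
  shows nderiv_eqI: "nderiv n f = D n" and smooth_funI: "smooth_fun f"
proof -
  have *: "nderiv n f = D n" for n
    by (induction n) (auto simp: assms(1) vector_derivative_at[OF assms(2)])
  show "nderiv n f = D n" by (rule *)
  show "smooth_fun f"
    unfolding smooth_fun_def * using assms(2)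
    by (auto intro: differentiableI_vector)
qed

lemma nderiv_has_vector_derivative:
  "smooth_fun f \<Longrightarrow> (nderiv n f has_vector_derivative nderiv (Suc n) f x) (at x)"
  by (simp add: smooth_fun_def vector_derivative_works[symmetric])

lemma continuous_nderiv: "smooth_fun f \<Longrightarrow> continuous_on S (nderiv n f)"
  by (meson continuous_at_imp_continuous_on differentiable_imp_continuous_within smooth_fun_def)

lemma continuous_smooth: "smooth_fun f \<Longrightarrow> continuous_on S f"
  using continuous_nderiv[of f S 0] by simp

context
  fixes f g :: "real \<Rightarrow> complex"
  assumes f: "smooth_fun f" and g: "smooth_fun g"
begin

lemma nderiv_add: "nderiv n (\<lambda>x. f x + g x) = (\<lambda>x. nderiv n f x + nderiv n g x)"
  and smooth_fun_add: "smooth_fun (\<lambda>x. f x + g x)"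
  by (rule nderivI[where D = "\<lambda>n x. nderiv n f x + nderiv n g x"];
      auto intro!: has_vector_derivative_add nderiv_has_vector_derivative f g
           simp del: nderiv.simps(2))+

lemma nderiv_diff: "nderiv n (\<lambda>x. f x - g x) = (\<lambda>x. nderiv n f x - nderiv n g x)"
  and smooth_fun_diff: "smooth_fun (\<lambda>x. f x - g x)"
  by (rule nderivI[where D = "\<lambda>n x. nderiv n f x - nderiv n g x"];
      auto intro!: has_vector_derivative_diff nderiv_has_vector_derivative f g
           simp del: nderiv.simps(2))+

text \<open>Pascal's rule splits each coefficient of order \<open>Suc n\<close> in two; after an
  index shift the halves are the two terms that the product rule produces from each summand.\<close>

lemma leibniz_has_vector_derivative:
  "((\<lambda>x. \<Sum>i\<le>n. of_nat (n choose i) * nderiv i f x * nderiv (n - i) g x) has_vector_derivative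
    (\<Sum>i\<le>Suc n. of_nat (Suc n choose i) * nderiv i f x * nderiv (Suc n - i) g x)) (at x)"
proof -
  let ?F = "\<lambda>i. nderiv i f x" and ?G = "\<lambda>i. nderiv i g x"
  have "(\<Sum>i\<le>Suc n. of_nat (Suc n choose i) * ?F i * ?G (Suc n - i))
      = ?F 0 * ?G (Suc n) + (\<Sum>i\<le>n. of_nat (Suc n choose Suc i) * ?F (Suc i) * ?G (n - i))"
    by (subst sum.atMost_Suc_shift) simp
  also have "(\<Sum>i\<le>n. of_nat (Suc n choose Suc i) * ?F (Suc i) * ?G (n - i))
      = (\<Sum>i\<le>n. of_nat (n choose i) * ?F (Suc i) * ?G (n - i))
        + (\<Sum>i\<le>n. of_nat (n choose Suc i) * ?F (Suc i) * ?G (n - i))"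
    by (simp add: algebra_simps sum.distrib del: nderiv.simps)
  also have "(\<Sum>i\<le>n. of_nat (n choose Suc i) * ?F (Suc i) * ?G (n - i))
      = (\<Sum>i\<le>Suc n. of_nat (n choose i) * ?F i * ?G (Suc n - i)) - ?F 0 * ?G (Suc n)"
    by (subst sum.atMost_Suc_shift) (simp del: nderiv.simps)
  \<comment> \<open>The top summand disappears because \<open>n choose Suc n\<close> is 0.\<close>
  also have "(\<Sum>i\<le>Suc n. of_nat (n choose i) * ?F i * ?G (Suc n - i))
      = (\<Sum>i\<le>n. of_nat (n choose i) * ?F i * ?G (Suc (n - i)))"
    by (simp add: Suc_diff_le del: nderiv.simps)
  finally have eq: "(\<Sum>i\<le>Suc n. of_nat (Suc n choose i) * ?F i * ?G (Suc n - i))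
      = (\<Sum>i\<le>n. of_nat (n choose i) * (?F i * ?G (Suc (n - i)) + ?F (Suc i) * ?G (n - i)))"
    by (simp add: algebra_simps sum.distrib del: nderiv.simps)
  show ?thesis
    unfolding eq unfolding mult.assoc
    by (intro has_vector_derivative_sum has_vector_derivative_mult_right
          has_vector_derivative_mult nderiv_has_vector_derivative f g)
qed

lemma nderiv_mult:
    "nderiv n (\<lambda>x. f x * g x) = (\<lambda>x. \<Sum>i\<le>n. of_nat (n choose i) * nderiv i f x * nderiv (n - i) g x)"
  and smooth_fun_mult: "smooth_fun (\<lambda>x. f x * g x)"
  by (rule nderivI[where D = "\<lambda>n x. \<Sum>i\<le>n. of_nat (n choose i) * nderiv i f x * nderiv (n - i) g x"];
      (rule leibniz_has_vector_derivative | simp))+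

end

lemma nderiv_const: "nderiv n (\<lambda>x. c) = (\<lambda>x. if n = 0 then c else 0)"
  and smooth_fun_const: "smooth_fun (\<lambda>x. c)"
  by (rule nderivI[where D = "\<lambda>n x. if n = 0 then c else 0"]; auto)+

lemma nderiv_cmult: "smooth_fun f \<Longrightarrow> nderiv n (\<lambda>x. c * f x) = (\<lambda>x. c * nderiv n f x)"
  and smooth_fun_cmult: "smooth_fun f \<Longrightarrow> smooth_fun (\<lambda>x. c * f x)"
  by (rule nderivI[where D = "\<lambda>n x. c * nderiv n f x"];
      auto intro!: has_vector_derivative_mult_right nderiv_has_vector_derivative
           simp del: nderiv.simps(2))+

lemma
  fixes c d :: real
  shows nderiv_affine: "smooth_fun f \<Longrightarrow> nderiv n (\<lambda>x. f (c * x + d)) = (\<lambda>x. of_real (c ^ n) * nderiv n f (c * x + d))"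
    and smooth_fun_affine: "smooth_fun f \<Longrightarrow> smooth_fun (\<lambda>x. f (c * x + d))"
proof -
  assume f: "smooth_fun f"
  have D: "((\<lambda>x. of_real (c ^ n) * nderiv n f (c * x + d)) has_vector_derivative
        of_real (c ^ Suc n) * nderiv (Suc n) f (c * x + d)) (at x)" for n x
  proof -
    have "((nderiv n f \<circ> (\<lambda>x. c * x + d)) has_vector_derivative c *\<^sub>R nderiv (Suc n) f (c * x + d)) (at x)"
      by (rule vector_diff_chain_at[OF _ nderiv_has_vector_derivative[OF f]])
         (auto intro!: derivative_eq_intros simp: has_real_derivative_iff_has_vector_derivative[symmetric])
    then have "((\<lambda>x. of_real (c ^ n) * nderiv n f (c * x + d)) has_vector_derivative
        of_real (c ^ n) * (c *\<^sub>R nderiv (Suc n) f (c * x + d))) (at x)"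
      unfolding o_def by (rule has_vector_derivative_mult_right)
    then show ?thesis by (simp add: scaleR_conv_of_real mult_ac del: nderiv.simps)
  qed
  show "nderiv n (\<lambda>x. f (c * x + d)) = (\<lambda>x. of_real (c ^ n) * nderiv n f (c * x + d))"
    and "smooth_fun (\<lambda>x. f (c * x + d))"
    by (rule nderivI[where D = "\<lambda>n x. of_real (c ^ n) * nderiv n f (c * x + d)"]; (rule D | simp))+
qed

lemma nderiv_exp: "nderiv n (\<lambda>x. complex_of_real (exp (- t * x)))
      = (\<lambda>x. of_real ((- t) ^ n * exp (- t * x)))"
  and smooth_fun_exp: "smooth_fun (\<lambda>x. complex_of_real (exp (- t * x)))"
proof -
  have D: "((\<lambda>x. complex_of_real ((- t) ^ n * exp (- t * x))) has_vector_derivative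
        of_real ((- t) ^ Suc n * exp (- t * x))) (at x)" for n x
    by (rule has_vector_derivative_of_real) (auto intro!: derivative_eq_intros)
  show "nderiv n (\<lambda>x. complex_of_real (exp (- t * x))) = (\<lambda>x. of_real ((- t) ^ n * exp (- t * x)))"
    and "smooth_fun (\<lambda>x. complex_of_real (exp (- t * x)))"
    by (rule nderivI[where D = "\<lambda>n x. complex_of_real ((- t) ^ n * exp (- t * x))"]; (rule D | simp))+
qed

text \<open>Derivatives are local. This reads off all derivatives of a cutoff, or of a product with
  it, on open sets where the cutoff is constant.\<close>

lemma nderiv_eq_on_open:
  assumes f: "smooth_fun f" and g: "smooth_fun g" and S: "open S" "\<And>x. x \<in> S \<Longrightarrow> f x = g x" and "x \<in> S"
  shows "nderiv n f x = nderiv n g x"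
  using \<open>x \<in> S\<close>
proof (induction n arbitrary: x)
  case (Suc n)
  have "(nderiv n g has_vector_derivative nderiv (Suc n) f x) (at x)"
    by (rule has_vector_derivative_transform_within_open
          [OF nderiv_has_vector_derivative[OF f] S(1) Suc.prems Suc.IH])
  from vector_derivative_at[OF this] show ?case by simp
qed (auto simp: S)

section \<open>A smooth cutoff\<close>

lemma poly_div_exp_tendsto_0: "((\<lambda>u::real. poly p u * exp (- u)) \<longlongrightarrow> 0) at_top"
proof -
  have "((\<lambda>u::real. \<Sum>i\<le>degree p. coeff p i * (u ^ i / exp u)) \<longlongrightarrow> (\<Sum>i\<le>degree p. coeff p i * 0)) at_top"
    by (intro tendsto_intros tendsto_power_div_exp_0)
  moreover have "(\<Sum>i\<le>degree p. coeff p i * (u ^ i / exp u)) = poly p u * exp (- u)" for u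
    by (simp add: poly_altdef sum_distrib_right exp_minus divide_inverse mult.assoc)
  ultimately show ?thesis by simp
qed

text \<open>These are the polynomials P_n for which the n-th derivative of exp(-1/x) is P_n(1/x)
  exp(-1/x). With u = 1/x one has d/dx = -u^2 d/du, and differentiating P(u) exp(-u) in u gives (P'
  - P)(u) exp(-u).\<close>

primrec flat_poly :: "nat \<Rightarrow> real poly" where
  "flat_poly 0 = 1"
| "flat_poly (Suc n) = monom 1 2 * (flat_poly n - pderiv (flat_poly n))"

definition flat_nderiv :: "nat \<Rightarrow> real \<Rightarrow> real" where
  "flat_nderiv n x = (if x > 0 then poly (flat_poly n) (1 / x) * exp (- (1 / x)) else 0)"

definition flat_fun :: "real \<Rightarrow> complex" where
  "flat_fun x = of_real (flat_nderiv 0 x)"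

lemma flat_nderiv_has_derivative:
  "(flat_nderiv n has_real_derivative flat_nderiv (Suc n) x) (at x)"
proof (cases x "0::real" rule: linorder_cases)
  case less
  have "((\<lambda>_. 0) has_real_derivative 0) (at x)" by simp
  then have "(flat_nderiv n has_real_derivative 0) (at x)"
    by (rule has_field_derivative_transform_within_open[where S = "{..<0}"])
       (use less in \<open>auto simp: flat_nderiv_def\<close>)
  then show ?thesis using less by (simp add: flat_nderiv_def)
next
  case greater
  have "((\<lambda>x. poly (flat_poly n) (1 / x) * exp (- (1 / x))) has_real_derivative
      poly (flat_poly (Suc n)) (1 / x) * exp (- (1 / x))) (at x)"
    using greater
    by (auto intro!: derivative_eq_intros poly_DERIV[THEN DERIV_chain2]
          simp: poly_monom field_simps power2_eq_square)
  then have "(flat_nderiv n has_real_derivative poly (flat_poly (Suc n)) (1 / x) * exp (- (1 / x))) (at x)"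
    by (rule has_field_derivative_transform_within_open[where S = "{0<..}"])
       (use greater in \<open>auto simp: flat_nderiv_def\<close>)
  then show ?thesis using greater by (simp add: flat_nderiv_def)
next
  case equal
  have "((\<lambda>y. flat_nderiv n y / y) \<longlongrightarrow> 0) (at_left 0)"
    by (rule tendsto_eventually) (auto simp: flat_nderiv_def eventually_at_filter)
  moreover have "((\<lambda>y. flat_nderiv n y / y) \<longlongrightarrow> 0) (at_right 0)"
  proof -
    \<comment> \<open>With u = 1/y the right difference quotient at 0 is u P_n(u) exp(-u): dividing
      by y only raises the degree by one.\<close>
    have "((\<lambda>y. poly (monom 1 1 * flat_poly n) (inverse y) * exp (- inverse y)) \<longlongrightarrow> 0) (at_right 0)"
      by (rule filterlim_compose[OF poly_div_exp_tendsto_0 filterlim_inverse_at_top_right])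
    then show ?thesis
      by (rule Lim_transform_eventually)
         (auto simp: flat_nderiv_def eventually_at_filter poly_monom field_simps)
  qed
  ultimately have "((\<lambda>y. flat_nderiv n y / y) \<longlongrightarrow> 0) (at 0)"
    by (rule filterlim_split_at)
  then show ?thesis
    using equal by (simp add: has_field_derivative_iff flat_nderiv_def)
qed

lemma smooth_fun_flat: "smooth_fun flat_fun"
  by (rule smooth_funI[where D = "\<lambda>n x. of_real (flat_nderiv n x)"])
     (auto simp: flat_fun_def intro!: has_vector_derivative_of_real flat_nderiv_has_derivative)

text \<open>The explicit points matter later: vanishing up to -1 confines estimates to [-1,
  \<infinity>), and the value 1 from -1/2 on leaves a margin around [0, \<infinity>), where g
  lives.\<close>

lemma cutoff_exists:
  obtains \<eta> where "cutoff \<eta>" "\<And>x. x \<le> -1 \<Longrightarrow> \<eta> x = 0" "\<And>x. x \<ge> -1/2 \<Longrightarrow> \<eta> x = 1"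
proof -
  \<comment> \<open>The cutoff is a normalised primitive of this bump function.\<close>
  define h where "h = (\<lambda>x. flat_fun (x + 1) * flat_fun (- x - 1/2))"
  define hr where "hr = (\<lambda>x. flat_nderiv 0 (x + 1) * flat_nderiv 0 (- x - 1/2))"
  have h_hr: "h x = of_real (hr x)" for x by (simp add: h_def hr_def flat_fun_def)
  have h: "smooth_fun h"
    unfolding h_def
    using smooth_fun_mult[OF smooth_fun_affine[OF smooth_fun_flat, of 1 1]
        smooth_fun_affine[OF smooth_fun_flat, of "-1" "-1/2"]] by simp
  have hr0: "hr x = 0" if "x \<le> -1 \<or> x \<ge> -1/2" for x
    using that by (auto simp: hr_def flat_nderiv_def)
  have hr_nonneg: "hr x \<ge> 0" for x by (simp add: hr_def flat_nderiv_def)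
  have hr_pos: "hr (-3/4) > 0" by (simp add: hr_def flat_nderiv_def)
  have hr_cont: "continuous_on S hr" for S
  proof -
    have "continuous_on S (flat_nderiv 0)" for S
      using flat_nderiv_has_derivative by (blast intro: DERIV_continuous_on DERIV_subset)
    then show ?thesis
      unfolding hr_def
      by (intro continuous_on_mult; rule continuous_on_compose2[OF _ _ subset_UNIV, of "flat_nderiv 0"])
         (auto intro!: continuous_intros)
  qed
  define I where "I = integral {-1..0} hr"
  have "I \<noteq> 0"
  proof
    assume "I = 0"
    then have "hr (-3/4) = 0"
      using integral_eq_0_iff[of "-1" 0 hr] hr_cont hr_nonneg by (auto simp: I_def)
    with hr_pos show False by simp
  qed
  \<comment> \<open>The lower limit lies strictly left of the support of \<open>hr\<close>, so that
    -1 is interior to the integration interval and the derivative there is two-sided.\<close>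
  define F where "F = (\<lambda>x. integral {-2..x} hr)"
  have F_left: "F x = 0" if "x \<le> -1" for x
  proof -
    have "integral {-2..x} hr = integral {-2..x} (\<lambda>_. 0)"
      by (rule integral_cong) (use that hr0 in auto)
    then show ?thesis by (simp add: F_def)
  qed
  have F_der: "(F has_real_derivative hr x) (at x)" for x
  proof (cases "x < -1")
    case True
    have "((\<lambda>_. 0) has_real_derivative 0) (at x)" by simp
    then have "(F has_real_derivative 0) (at x)"
      by (rule has_field_derivative_transform_within_open[where S = "{..<-1}"])
         (use True F_left in auto)
    then show ?thesis using True hr0 by simp
  next
    case False
    have "(F has_real_derivative hr x) (at x within {-2..x+1})"
      unfolding F_def by (rule integral_has_real_derivative) (use False hr_cont in auto)
    moreover have "at x within {-2..x+1} = at x"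
      using False by (intro at_within_interior) auto
    ultimately show ?thesis by simp
  qed
  have F_right: "F x = I" if "x \<ge> -1/2" for x
  proof -
    have int: "hr integrable_on {u..v}" for u v
      using hr_cont integrable_continuous_interval by blast
    have "integral {-2..x} hr = integral {-2..-1} hr + integral {-1..x} hr"
      using that int by (intro Henstock_Kurzweil_Integration.integral_combine[symmetric]) auto
    also have "integral {-2..-1} hr = 0" using F_left[of "-1"] by (simp add: F_def)
    also have "integral {-1..x} hr = integral {-1..-1/2} hr + integral {-1/2..x} hr"
      using that int by (intro Henstock_Kurzweil_Integration.integral_combine[symmetric]) auto
    also have "integral {-1/2..x} hr = integral {-1/2..x} (\<lambda>_. 0)"
      by (rule integral_cong) (use that hr0 in auto)
    also have "\<dots> = integral {-1/2..0} hr"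
    proof -
      have "integral {-1/2..0} hr = integral {-1/2..0::real} (\<lambda>_. 0)"
        by (rule integral_cong) (use that hr0 in auto)
      then show ?thesis by simp
    qed
    also have "integral {-1..-1/2} hr + integral {-1/2..0} hr = I"
      unfolding I_def using int by (intro Henstock_Kurzweil_Integration.integral_combine) auto
    finally show ?thesis by (simp add: F_def)
  qed
  define \<eta> where "\<eta> = (\<lambda>x. complex_of_real (1 / I) * of_real (F x))"
  have "smooth_fun (\<lambda>x. complex_of_real (F x))"
  proof (rule smooth_funI[where D = "\<lambda>n. case n of 0 \<Rightarrow> (\<lambda>x. of_real (F x)) | Suc m \<Rightarrow> nderiv m h"])
    fix n x
    show "((case n of 0 \<Rightarrow> (\<lambda>x. complex_of_real (F x)) | Suc m \<Rightarrow> nderiv m h) has_vector_derivative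
        (case Suc n of 0 \<Rightarrow> (\<lambda>x. complex_of_real (F x)) | Suc m \<Rightarrow> nderiv m h) x) (at x)"
    proof (cases n)
      case 0
      then show ?thesis
        by (auto simp: h_hr intro!: has_vector_derivative_of_real F_der)
    next
      case (Suc m)
      then show ?thesis using nderiv_has_vector_derivative[OF h, of m x] by simp
    qed
  qed auto
  then have "smooth_fun \<eta>" unfolding \<eta>_def by (rule smooth_fun_cmult)
  moreover have l: "\<eta> x = 0" if "x \<le> -1" for x using F_left that by (simp add: \<eta>_def)
  moreover have r: "\<eta> x = 1" if "x \<ge> -1/2" for x using F_right that \<open>I \<noteq> 0\<close> by (simp add: \<eta>_def)
  ultimately have "cutoff \<eta>"
    unfolding cutoff_def by (intro conjI exI[of _ "1/2"] exI[of _ "-1"]) auto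
  from this l r show ?thesis by (rule that)
qed

section \<open>Schwartz functions and their seminorms\<close>

text \<open>One explicit bound for all weights and orders up to N replaces the suprema in
  \<open>schwartz_seminorm\<close>; estimates then carry no \<open>bdd_above\<close> side
  conditions, and for B > 0 the condition describes a neighbourhood of 0 in the Schwartz
  space.\<close>

definition schwartz_bound :: "nat \<Rightarrow> real \<Rightarrow> (real \<Rightarrow> complex) \<Rightarrow> bool" where
  "schwartz_bound N B f \<longleftrightarrow> (\<forall>j\<le>N. \<forall>k\<le>N. \<forall>x. \<bar>x\<bar> ^ j * norm (nderiv k f x) \<le> B)"

lemma schwartz_boundD:
  "schwartz_bound N B f \<Longrightarrow> j \<le> N \<Longrightarrow> k \<le> N \<Longrightarrow> \<bar>x\<bar> ^ j * norm (nderiv k f x) \<le> B"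
  by (auto simp: schwartz_bound_def)

lemma schwartz_bound_norm: "schwartz_bound N B f \<Longrightarrow> norm (f x) \<le> B"
  using schwartz_boundD[of N B f 0 0 x] by simp

lemma schwartz_bound_nonneg: "schwartz_bound N B f \<Longrightarrow> B \<ge> 0"
  by (rule order_trans[OF norm_ge_zero schwartz_bound_norm])

lemma schwartz_bound_mono: "schwartz_bound N B f \<Longrightarrow> M \<le> N \<Longrightarrow> B \<le> B' \<Longrightarrow> schwartz_bound M B' f"
  unfolding schwartz_bound_def[of M]
  by (intro allI impI, rule order_trans[OF schwartz_boundD]) (assumption | simp)+

lemma schwartz_smooth: "schwartz f \<Longrightarrow> smooth_fun f"
  by (simp add: schwartz_def)

lemma schwartz_bound_exists:
  assumes "schwartz f"
  shows "\<exists>B. schwartz_bound N B f"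
proof -
  from assms have "\<forall>j k. \<exists>C. \<forall>x. \<bar>x\<bar> ^ j * norm (nderiv k f x) \<le> C" by (simp add: schwartz_def)
  then obtain C where C: "\<And>j k x. \<bar>x\<bar> ^ j * norm (nderiv k f x) \<le> C j k" by metis
  have C0: "C j k \<ge> 0" for j k
    using order_trans[OF _ C[of 0 j k]] by simp
  have "schwartz_bound N (\<Sum>(j, k)\<in>{..N} \<times> {..N}. C j k) f"
    unfolding schwartz_bound_def
  proof (intro allI impI)
    fix j k x assume "j \<le> N" "k \<le> N"
    then have "C j k \<le> (\<Sum>(j, k)\<in>{..N} \<times> {..N}. C j k)"
      using member_le_sum[of "(j, k)" "{..N} \<times> {..N}" "\<lambda>(j, k). C j k"] C0 by auto
    with C[of x j k] show "\<bar>x\<bar> ^ j * norm (nderiv k f x) \<le> (\<Sum>(j, k)\<in>{..N} \<times> {..N}. C j k)"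
      by linarith
  qed
  then show ?thesis by blast
qed

lemma schwartzI: "smooth_fun f \<Longrightarrow> (\<And>N. \<exists>B. schwartz_bound N B f) \<Longrightarrow> schwartz f"
  unfolding schwartz_def
proof (intro conjI allI)
  fix j k assume *: "\<And>N. \<exists>B. schwartz_bound N B f"
  obtain B where "schwartz_bound (max j k) B f" using * by blast
  from schwartz_boundD[OF this, of j k] show "\<exists>C. \<forall>x. \<bar>x\<bar> ^ j * norm (nderiv k f x) \<le> C" by auto
qed

lemma schwartz_bound_add:
  assumes "smooth_fun f" "smooth_fun g" "schwartz_bound N A f" "schwartz_bound N B g"
  shows "schwartz_bound N (A + B) (\<lambda>x. f x + g x)"
  unfolding schwartz_bound_def nderiv_add[OF assms(1,2)]
proof (intro allI impI)
  fix j k x assume "j \<le> N" "k \<le> N"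
  have "\<bar>x\<bar> ^ j * norm (nderiv k f x + nderiv k g x) \<le> \<bar>x\<bar> ^ j * (norm (nderiv k f x) + norm (nderiv k g x))"
    by (intro mult_left_mono norm_triangle_ineq) auto
  also have "\<dots> \<le> A + B"
    using schwartz_boundD[OF assms(3) \<open>j \<le> N\<close> \<open>k \<le> N\<close>, of x]
      schwartz_boundD[OF assms(4) \<open>j \<le> N\<close> \<open>k \<le> N\<close>, of x] by (simp add: distrib_left)
  finally show "\<bar>x\<bar> ^ j * norm (nderiv k f x + nderiv k g x) \<le> A + B" .
qed

lemma schwartz_bound_cmult:
  assumes "smooth_fun f" "schwartz_bound N B f"
  shows "schwartz_bound N (norm c * B) (\<lambda>x. c * f x)"
  unfolding schwartz_bound_def nderiv_cmult[OF assms(1)]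
  using schwartz_boundD[OF assms(2)]
  by (auto simp: norm_mult mult.left_commute intro!: mult_left_mono)

lemma schwartz_add:
  assumes "schwartz f" "schwartz g"
  shows "schwartz (\<lambda>x. f x + g x)"
proof (rule schwartzI)
  note sm = assms[THEN schwartz_smooth]
  show "smooth_fun (\<lambda>x. f x + g x)" by (rule smooth_fun_add[OF sm])
  fix N
  obtain A B where "schwartz_bound N A f" "schwartz_bound N B g"
    using assms[THEN schwartz_bound_exists] by blast
  from schwartz_bound_add[OF sm this] show "\<exists>B. schwartz_bound N B (\<lambda>x. f x + g x)" ..
qed

lemma schwartz_cmult:
  assumes "schwartz f"
  shows "schwartz (\<lambda>x. c * f x)"
proof (rule schwartzI)
  note sm = assms[THEN schwartz_smooth]
  show "smooth_fun (\<lambda>x. c * f x)" by (rule smooth_fun_cmult[OF sm])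
  fix N
  obtain B where "schwartz_bound N B f" using assms[THEN schwartz_bound_exists] by blast
  from schwartz_bound_cmult[OF sm this] show "\<exists>B. schwartz_bound N B (\<lambda>x. c * f x)" ..
qed

lemma schwartz_diff:
  assumes "schwartz f" "schwartz g" shows "schwartz (\<lambda>x. f x - g x)"
  using schwartz_add[OF assms(1) schwartz_cmult[OF assms(2), of "-1"]] by simp

lemma schwartz_zero: "schwartz (\<lambda>x. 0)"
  by (rule schwartzI) (auto simp: smooth_fun_const nderiv_const schwartz_bound_def)

lemma smooth_fun_dilate: "smooth_fun f \<Longrightarrow> smooth_fun (\<lambda>x. f (x / l))"
  using smooth_fun_affine[of f "1 / l" 0] by simp

text \<open>The weight |x|^j costs l^j and the k-th derivative gains l^(-k) \<le> 1. The growth in l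
  is harmless, because this bound only serves continuity for each fixed l.\<close>

lemma schwartz_bound_dilate:
  assumes "smooth_fun f" "schwartz_bound N B f" "l \<ge> 1"
  shows "schwartz_bound N (l ^ N * B) (\<lambda>x. f (x / l))"
  unfolding schwartz_bound_def
proof (intro allI impI)
  fix j k x assume jk: "j \<le> N" "k \<le> N"
  have n: "nderiv k (\<lambda>x. f (x / l)) x = of_real ((1 / l) ^ k) * nderiv k f (x / l)"
    using fun_cong[OF nderiv_affine[OF assms(1), where n = k and c = "1 / l" and d = 0], of x] by simp
  have "\<bar>x\<bar> ^ j * norm (nderiv k (\<lambda>x. f (x / l)) x)
      = (1 / l) ^ k * (l ^ j * (\<bar>x / l\<bar> ^ j * norm (nderiv k f (x / l))))"
    unfolding n using \<open>l \<ge> 1\<close> by (simp add: norm_mult norm_power norm_divide power_divide abs_mult)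
  also have "\<dots> \<le> 1 * (l ^ N * B)"
    using \<open>l \<ge> 1\<close> jk schwartz_boundD[OF assms(2) jk, of "x / l"]
    by (intro mult_mono power_le_one power_increasing) auto
  finally show "\<bar>x\<bar> ^ j * norm (nderiv k (\<lambda>x. f (x / l)) x) \<le> l ^ N * B" by simp
qed

lemma schwartz_dilate:
  assumes "schwartz f" "l \<ge> 1"
  shows "schwartz (\<lambda>x. f (x / l))"
proof (rule schwartzI)
  note sm = schwartz_smooth[OF assms(1)]
  show "smooth_fun (\<lambda>x. f (x / l))" by (rule smooth_fun_dilate[OF sm])
  fix N
  obtain B where "schwartz_bound N B f" using schwartz_bound_exists[OF assms(1)] by blast
  from schwartz_bound_dilate[OF sm this assms(2)] show "\<exists>B. schwartz_bound N B (\<lambda>x. f (x / l))" ..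
qed

section \<open>Temperedness and products with a cutoff\<close>

lemma tempered_bound:
  assumes "tempered T"
  obtains C N where "C \<ge> 0" "\<And>\<phi> B. schwartz \<phi> \<Longrightarrow> schwartz_bound N B \<phi> \<Longrightarrow> norm (T \<phi>) \<le> C * B"
proof -
  from assms obtain C N where CN: "\<And>\<phi>. schwartz \<phi> \<Longrightarrow>
      norm (T \<phi>) \<le> C * (\<Sum>j\<le>N. \<Sum>k\<le>N. schwartz_seminorm j k \<phi>)"
    unfolding tempered_def by blast
  show ?thesis
  \<comment> \<open>The square of \<open>Suc N\<close> counts the seminorms in the double sum; the
    absolute value is there because the definition does not prescribe the sign of C.\<close>
  proof (rule that[of "\<bar>C\<bar> * (real (Suc N) * real (Suc N))" N])
    fix \<phi> B assume \<phi>: "schwartz \<phi>" and B: "schwartz_bound N B \<phi>"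
    have *: "0 \<le> schwartz_seminorm j k \<phi> \<and> schwartz_seminorm j k \<phi> \<le> B" if "j \<le> N" "k \<le> N" for j k
    proof -
      have bdd: "bdd_above (range (\<lambda>x. \<bar>x\<bar> ^ j * norm (nderiv k \<phi> x)))"
        by (rule bdd_aboveI[of _ B]) (use schwartz_boundD[OF B that] in auto)
      have "0 \<le> \<bar>0\<bar> ^ j * norm (nderiv k \<phi> 0)" by simp
      also have "\<dots> \<le> schwartz_seminorm j k \<phi>"
        unfolding schwartz_seminorm_def by (rule cSUP_upper[OF _ bdd]) simp
      finally show ?thesis
        using schwartz_boundD[OF B that] by (auto simp: schwartz_seminorm_def intro!: cSUP_least)
    qed
    have "norm (T \<phi>) \<le> C * (\<Sum>j\<le>N. \<Sum>k\<le>N. schwartz_seminorm j k \<phi>)" by (rule CN[OF \<phi>])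
    also have "\<dots> \<le> \<bar>C\<bar> * (\<Sum>j\<le>N. \<Sum>k\<le>N. schwartz_seminorm j k \<phi>)"
      using * by (intro mult_right_mono sum_nonneg) auto
    also have "\<dots> \<le> \<bar>C\<bar> * (\<Sum>j\<le>N. \<Sum>k\<le>N. B)"
      using * by (intro mult_left_mono sum_mono) auto
    finally show "norm (T \<phi>) \<le> \<bar>C\<bar> * (real (Suc N) * real (Suc N)) * B" by (simp add: mult.assoc)
  qed simp
qed

text \<open>The binomial coefficients of Leibniz' formula sum to 2^n. The factor w is a slot for the
  weight |x|^j.\<close>

lemma nderiv_mult_weighted_bound:
  assumes f: "smooth_fun f" and g: "smooth_fun g" and "w \<ge> 0"
    and le: "\<And>i m. i \<le> n \<Longrightarrow> m \<le> n \<Longrightarrow> w * (norm (nderiv i f x) * norm (nderiv m g x)) \<le> c"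
  shows "w * norm (nderiv n (\<lambda>x. f x * g x) x) \<le> 2 ^ n * c"
proof -
  have "w * norm (nderiv n (\<lambda>x. f x * g x) x)
      \<le> w * (\<Sum>i\<le>n. norm (of_nat (n choose i) * nderiv i f x * nderiv (n - i) g x))"
    unfolding nderiv_mult[OF f g] using \<open>w \<ge> 0\<close> by (intro mult_left_mono norm_sum)
  also have "\<dots> = (\<Sum>i\<le>n. real (n choose i) * (w * (norm (nderiv i f x) * norm (nderiv (n - i) g x))))"
    by (simp add: sum_distrib_left norm_mult mult_ac)
  also have "\<dots> \<le> (\<Sum>i\<le>n. real (n choose i) * c)"
    by (intro sum_mono mult_left_mono le) auto
  also have "\<dots> = 2 ^ n * c"
    by (simp flip: sum_distrib_right of_nat_sum add: choose_row_sum)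
  finally show ?thesis .
qed

lemma cutoff_smooth: "cutoff \<eta> \<Longrightarrow> smooth_fun \<eta>"
  by (simp add: cutoff_def)

text \<open>The cutoff is constant on both ends of the line, and the remaining interval is
  compact.\<close>

lemma cutoff_nderiv_bounded:
  assumes "cutoff \<eta>"
  obtains A where "A \<ge> 0" "\<And>k x. k \<le> N \<Longrightarrow> norm (nderiv k \<eta> x) \<le> A"
proof -
  note sm = cutoff_smooth[OF assms]
  from assms obtain e c where e: "e > 0" "\<And>x. x \<ge> - e \<Longrightarrow> \<eta> x = 1" and c: "\<And>x. x \<le> c \<Longrightarrow> \<eta> x = 0"
    unfolding cutoff_def by metis
  have "\<exists>A. \<forall>x. norm (nderiv k \<eta> x) \<le> A" for k
  proof -
    have "bounded (nderiv k \<eta> ` {c..-e})"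
      by (intro compact_imp_bounded compact_continuous_image continuous_nderiv sm) simp
    then obtain A where A: "\<And>x. x \<in> {c..-e} \<Longrightarrow> norm (nderiv k \<eta> x) \<le> A"
      unfolding bounded_iff by blast
    have "norm (nderiv k \<eta> x) \<le> max A 1" for x
    proof -
      consider "x \<in> {..<c}" | "x \<in> {-e<..}" | "x \<in> {c..-e}" by force
      then show ?thesis
      proof cases
        case 1
        then have "nderiv k \<eta> x = nderiv k (\<lambda>_. 0) x"
          using c by (intro nderiv_eq_on_open[OF sm smooth_fun_const, of "{..<c}"]) auto
        then show ?thesis by (simp add: nderiv_const)
      next
        case 2
        then have "nderiv k \<eta> x = nderiv k (\<lambda>_. 1) x"
          using e by (intro nderiv_eq_on_open[OF sm smooth_fun_const, of "{-e<..}"]) auto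
        then show ?thesis by (simp add: nderiv_const le_max_iff_disj)
      next
        case 3
        with A show ?thesis by (simp add: le_max_iff_disj)
      qed
    qed
    then show ?thesis by blast
  qed
  then obtain A where A: "\<And>k x. norm (nderiv k \<eta> x) \<le> A k" by metis
  have A0: "A k \<ge> 0" for k using order_trans[OF norm_ge_zero A] .
  show ?thesis
  proof (rule that[of "\<Sum>k\<le>N. A k"])
    fix k x assume "k \<le> N"
    then have "A k \<le> (\<Sum>k\<le>N. A k)" using A0 by (intro member_le_sum) auto
    with A[of k x] show "norm (nderiv k \<eta> x) \<le> (\<Sum>k\<le>N. A k)" by linarith
  qed (use A0 in \<open>auto intro: sum_nonneg\<close>)
qed

text \<open>K depends on the cutoff and on N, but not on f, and f is controlled only where the
  cutoff may be nonzero. This admits exponentials, which are unbounded on the left, and makes an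
  approximation on a half-line an approximation in the Schwartz space.\<close>

lemma cutoff_mult_bound:
  assumes "cutoff \<eta>" and c: "\<And>x. x \<le> c \<Longrightarrow> \<eta> x = 0"
  obtains K where "K \<ge> 0"
    "\<And>f B. smooth_fun f \<Longrightarrow> (\<And>j k x. j \<le> N \<Longrightarrow> k \<le> N \<Longrightarrow> x \<ge> c \<Longrightarrow> \<bar>x\<bar> ^ j * norm (nderiv k f x) \<le> B) \<Longrightarrow>
      schwartz_bound N (K * B) (\<lambda>x. \<eta> x * f x)"
proof -
  note sm = cutoff_smooth[OF assms(1)]
  obtain A where A: "A \<ge> 0" "\<And>k x. k \<le> N \<Longrightarrow> norm (nderiv k \<eta> x) \<le> A"
    by (rule cutoff_nderiv_bounded[OF assms(1), of N]) blast
  show ?thesis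
  proof (rule that[of "2 ^ N * A"])
    fix f B
    assume f: "smooth_fun f"
      and B: "\<And>j k x. j \<le> N \<Longrightarrow> k \<le> N \<Longrightarrow> x \<ge> c \<Longrightarrow> \<bar>x\<bar> ^ j * norm (nderiv k f x) \<le> B"
    have "norm (f c) \<le> B" using B[of 0 0 c] by simp
    then have B0: "B \<ge> 0" by (rule order_trans[OF norm_ge_zero])
    show "schwartz_bound N (2 ^ N * A * B) (\<lambda>x. \<eta> x * f x)"
      unfolding schwartz_bound_def
    proof (intro allI impI)
      fix j k x assume jk: "j \<le> N" "k \<le> N"
      show "\<bar>x\<bar> ^ j * norm (nderiv k (\<lambda>x. \<eta> x * f x) x) \<le> 2 ^ N * A * B"
      proof (cases "x < c")
        case True
        then have "nderiv k (\<lambda>x. \<eta> x * f x) x = nderiv k (\<lambda>_. 0) x"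
          using c by (intro nderiv_eq_on_open[OF smooth_fun_mult[OF sm f] smooth_fun_const, of "{..<c}"]) auto
        then show ?thesis using A B0 by (simp add: nderiv_const)
      next
        case False
        have "\<bar>x\<bar> ^ j * norm (nderiv k (\<lambda>x. \<eta> x * f x) x) \<le> 2 ^ k * (A * B)"
        proof (rule nderiv_mult_weighted_bound[OF sm f])
          fix i m assume im: "i \<le> k" "m \<le> k"
          have "norm (nderiv i \<eta> x) * (\<bar>x\<bar> ^ j * norm (nderiv m f x)) \<le> A * B"
            using im jk False A by (intro mult_mono B) auto
          then show "\<bar>x\<bar> ^ j * (norm (nderiv i \<eta> x) * norm (nderiv m f x)) \<le> A * B"
            by (simp add: mult_ac)
        qed simp
        also have "\<dots> \<le> 2 ^ N * (A * B)"
          using A B0 jk by (intro mult_right_mono power_increasing) auto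
        finally show ?thesis by (simp add: mult.assoc)
      qed
    qed
  qed (use A in simp)
qed

lemma schwartz_cutoff_mult:
  assumes "cutoff \<eta>" "\<And>x. x \<le> c \<Longrightarrow> \<eta> x = 0" "smooth_fun f"
    and "\<And>N. \<exists>B. \<forall>j\<le>N. \<forall>k\<le>N. \<forall>x\<ge>c. \<bar>x\<bar> ^ j * norm (nderiv k f x) \<le> B"
  shows "schwartz (\<lambda>x. \<eta> x * f x)"
proof (rule schwartzI)
  show "smooth_fun (\<lambda>x. \<eta> x * f x)" by (intro smooth_fun_mult cutoff_smooth assms)
  fix N
  obtain B where B: "\<And>j k x. j \<le> N \<Longrightarrow> k \<le> N \<Longrightarrow> x \<ge> c \<Longrightarrow> \<bar>x\<bar> ^ j * norm (nderiv k f x) \<le> B"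
    using assms(4)[of N] by auto
  show "\<exists>B. schwartz_bound N B (\<lambda>x. \<eta> x * f x)"
  proof (rule cutoff_mult_bound[OF assms(1,2), of c N])
    fix K assume "\<And>f B. smooth_fun f \<Longrightarrow>
        (\<And>j k x. j \<le> N \<Longrightarrow> k \<le> N \<Longrightarrow> x \<ge> c \<Longrightarrow> \<bar>x\<bar> ^ j * norm (nderiv k f x) \<le> B) \<Longrightarrow>
        schwartz_bound N (K * B) (\<lambda>x. \<eta> x * f x)"
    from this[OF assms(3) B] show ?thesis by blast
  qed
qed

lemma schwartz_cutoff_mult_schwartz:
  assumes "cutoff \<eta>" "schwartz f"
  shows "schwartz (\<lambda>x. \<eta> x * f x)"
proof -
  obtain c where "\<And>x. x \<le> c \<Longrightarrow> \<eta> x = 0"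
    using assms(1) unfolding cutoff_def by blast
  moreover have "\<exists>B. \<forall>j\<le>N. \<forall>k\<le>N. \<forall>x\<ge>c. \<bar>x\<bar> ^ j * norm (nderiv k f x) \<le> B" for N
    using schwartz_bound_exists[OF assms(2), of N] unfolding schwartz_bound_def by blast
  ultimately show ?thesis
    using schwartz_cutoff_mult[OF assms(1)] schwartz_smooth[OF assms(2)] by blast
qed

lemma power_exp_bounded:
  fixes t c :: real
  assumes "t > 0"
  obtains K where "K \<ge> 0" "\<And>j x. j \<le> N \<Longrightarrow> x \<ge> c \<Longrightarrow> \<bar>x\<bar> ^ j * exp (- t * x) \<le> K"
proof -
  have "\<exists>K. \<forall>x\<ge>c. \<bar>x\<bar> ^ j * exp (- t * x) \<le> K" for j
  proof -
    have "filterlim (\<lambda>x. t * x) at_top at_top"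
      using assms by (intro filterlim_tendsto_pos_mult_at_top[OF tendsto_const]) (auto simp: filterlim_ident)
    from filterlim_compose[OF tendsto_power_div_exp_0[of j] this]
    have "((\<lambda>x. (t * x) ^ j / exp (t * x)) \<longlongrightarrow> 0) at_top" .
    from order_tendstoD(2)[OF this, of 1] obtain x0 where x0: "\<And>x. x \<ge> x0 \<Longrightarrow> (t * x) ^ j / exp (t * x) < 1"
      by (auto simp: eventually_at_top_linorder)
    have "bounded ((\<lambda>x. \<bar>x\<bar> ^ j * exp (- t * x)) ` {c..max x0 0})"
      by (intro compact_imp_bounded compact_continuous_image continuous_intros) simp
    then obtain A where A: "\<And>x. x \<in> {c..max x0 0} \<Longrightarrow> \<bar>x\<bar> ^ j * exp (- t * x) \<le> A"
      unfolding bounded_iff by (metis (no_types, lifting) abs_le_D1 imageI real_norm_def)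
    have "\<bar>x\<bar> ^ j * exp (- t * x) \<le> max A ((1 / t) ^ j)" if "x \<ge> c" for x
    proof (cases "x \<le> max x0 0")
      case True
      with A that show ?thesis by (simp add: le_max_iff_disj)
    next
      case False
      then have "(t * x) ^ j / exp (t * x) < 1" "x > 0" using x0 by auto
      then have "\<bar>x\<bar> ^ j * exp (- t * x) \<le> (1 / t) ^ j"
        using assms by (simp add: power_mult_distrib field_simps exp_minus)
      then show ?thesis by simp
    qed
    then show ?thesis by blast
  qed
  then obtain K where K: "\<And>j x. x \<ge> c \<Longrightarrow> \<bar>x\<bar> ^ j * exp (- t * x) \<le> K j" by metis
  have K0: "K j \<ge> 0" for j
    using order_trans[OF _ K[OF order_refl, of j]] by simp
  show ?thesis
  proof (rule that[of "\<Sum>j\<le>N. K j"])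
    fix j x assume "j \<le> N" "x \<ge> c"
    then have "K j \<le> (\<Sum>j\<le>N. K j)" using K0 by (intro member_le_sum) auto
    with K[OF \<open>x \<ge> c\<close>, of j] show "\<bar>x\<bar> ^ j * exp (- t * x) \<le> (\<Sum>j\<le>N. K j)" by linarith
  qed (use K0 in \<open>auto intro: sum_nonneg\<close>)
qed

lemma schwartz_cutoff_exp:
  assumes "cutoff \<eta>" "t > 0"
  shows "schwartz (\<lambda>x. \<eta> x * complex_of_real (exp (- t * x)))"
proof -
  obtain c where c: "\<And>x. x \<le> c \<Longrightarrow> \<eta> x = 0"
    using assms(1) unfolding cutoff_def by blast
  have "\<exists>B. \<forall>j\<le>N. \<forall>k\<le>N. \<forall>x\<ge>c. \<bar>x\<bar> ^ j * norm (nderiv k (\<lambda>x. complex_of_real (exp (- t * x))) x) \<le> B" for N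
  proof -
    obtain K where K: "K \<ge> 0" "\<And>j x. j \<le> N \<Longrightarrow> x \<ge> c \<Longrightarrow> \<bar>x\<bar> ^ j * exp (- t * x) \<le> K"
      by (rule power_exp_bounded[OF assms(2), of N c]) blast
    have "\<bar>x\<bar> ^ j * norm (nderiv k (\<lambda>x. complex_of_real (exp (- t * x))) x) \<le> max 1 t ^ N * K"
      if "j \<le> N" "k \<le> N" "x \<ge> c" for j k x
    proof -
      have "t ^ k \<le> max 1 t ^ N"
        using assms(2) that 
        by (intro order_trans[OF power_mono[of t "max 1 t" k] power_increasing]) auto
      then have "t ^ k * (\<bar>x\<bar> ^ j * exp (- t * x)) \<le> max 1 t ^ N * K"
        using that K by (intro mult_mono) auto
      then show ?thesis
        using assms(2) unfolding nderiv_exp by (simp add: norm_mult norm_power abs_mult mult_ac)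
    qed
    then show ?thesis by blast
  qed
  then show ?thesis by (intro schwartz_cutoff_mult[OF assms(1) c] smooth_fun_exp)
qed

section \<open>Completeness and uniform boundedness\<close>

text \<open>Completeness in the form that a gliding hump needs: the k-th step is small in order k,
  and halving the radii makes the whole tail after k as small as twice the k-th radius.\<close>

lemma schwartz_complete:
  assumes X: "\<And>k. schwartz (X k)" and d0: "\<And>k. d k > 0" and d: "\<And>k. d (Suc k) \<le> d k / 2"
    and step: "\<And>k. schwartz_bound k (d k) (\<lambda>x. X (Suc k) x - X k x)"
  obtains f where "schwartz f" "\<And>k. schwartz_bound k (2 * d k) (\<lambda>x. f x - X k x)"
proof -
  note sm = schwartz_smooth[OF X]
  have dec: "m \<ge> k \<Longrightarrow> d m \<le> d k" for k m
  proof (induction m rule: dec_induct)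
    case (step m)
    then show ?case using d[of m] d0[of m] by linarith
  qed simp
  have d_lim: "d \<longlonglongrightarrow> 0"
  proof -
    have le: "d k \<le> d 0 * (1/2) ^ k" for k
    proof (induction k)
      case (Suc k)
      then show ?case using d[of k] by simp
    qed simp
    have "(\<lambda>k. d 0 * (1/2) ^ k) \<longlonglongrightarrow> d 0 * 0"
      by (intro tendsto_intros LIMSEQ_power_zero) auto
    then have "(\<lambda>k. d 0 * (1/2) ^ k) \<longlonglongrightarrow> 0" by simp
    then show ?thesis
      by (rule tendsto_sandwich[OF _ _ tendsto_const, rotated 2])
         (use le d0 in \<open>auto intro: always_eventually less_imp_le\<close>)
  qed
  \<comment> \<open>The bound telescopes: halving gives
    \<open>d m \<le> 2 * d m - 2 * d (Suc m)\<close>.\<close>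
  have cauchy: "\<bar>x\<bar> ^ j * norm (nderiv n (X m) x - nderiv n (X k) x) \<le> 2 * d k - 2 * d m"
    if "m \<ge> k" "j \<le> k" "n \<le> k" for m k n j x
    using that(1)
  proof (induction m rule: dec_induct)
    case base
    then show ?case by simp
  next
    case (step m)
    have "\<bar>x\<bar> ^ j * norm (nderiv n (X (Suc m)) x - nderiv n (X k) x)
        \<le> \<bar>x\<bar> ^ j * (norm (nderiv n (X (Suc m)) x - nderiv n (X m) x) + norm (nderiv n (X m) x - nderiv n (X k) x))"
      using norm_triangle_ineq[of "nderiv n (X (Suc m)) x - nderiv n (X m) x" "nderiv n (X m) x - nderiv n (X k) x"]
      by (intro mult_left_mono) auto
    also have "\<bar>x\<bar> ^ j * norm (nderiv n (X (Suc m)) x - nderiv n (X m) x) \<le> d m"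
      using schwartz_boundD[OF assms(4), of j m n x] step that by (simp add: nderiv_diff sm)
    then have "\<bar>x\<bar> ^ j * (norm (nderiv n (X (Suc m)) x - nderiv n (X m) x) + norm (nderiv n (X m) x - nderiv n (X k) x))
        \<le> d m + (2 * d k - 2 * d m)"
      using step.IH by (simp add: distrib_left)
    also have "\<dots> \<le> 2 * d k - 2 * d (Suc m)" using d[of m] by simp
    finally show ?case .
  qed
  have conv: "convergent (\<lambda>k. nderiv n (X k) x)" for n x
  proof (rule Cauchy_convergent, rule metric_CauchyI)
    fix e :: real assume "e > 0"
    then have "eventually (\<lambda>k. d k < e / 4) sequentially"
      using order_tendstoD(2)[OF d_lim, of "e / 4"] by simp
    then obtain k0 where k0: "\<And>k. k \<ge> k0 \<Longrightarrow> d k < e / 4" by (auto simp: eventually_sequentially)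
    let ?K = "max k0 n"
    have *: "dist (nderiv n (X m) x) (nderiv n (X ?K) x) < e / 2" if "m \<ge> ?K" for m
      using cauchy[OF that, of 0 n x] k0[of ?K] d0[of m] by (simp add: dist_norm)
    show "\<exists>M. \<forall>m\<ge>M. \<forall>k\<ge>M. dist (nderiv n (X m) x) (nderiv n (X k) x) < e"
      using * by (meson dist_triangle_half_l)
  qed
  define L where "L = (\<lambda>n x. lim (\<lambda>k. nderiv n (X k) x))"
  have L: "(\<lambda>k. nderiv n (X k) x) \<longlonglongrightarrow> L n x" for n x
    using conv convergent_LIMSEQ_iff unfolding L_def by blast
  have L_bd: "\<bar>x\<bar> ^ j * norm (L n x - nderiv n (X k) x) \<le> 2 * d k" if "j \<le> k" "n \<le> k" for j n k x
  proof (rule tendsto_upperbound)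
    show "(\<lambda>m. \<bar>x\<bar> ^ j * norm (nderiv n (X m) x - nderiv n (X k) x)) \<longlonglongrightarrow> \<bar>x\<bar> ^ j * norm (L n x - nderiv n (X k) x)"
      by (intro tendsto_intros L)
    show "\<forall>\<^sub>F m in sequentially. \<bar>x\<bar> ^ j * norm (nderiv n (X m) x - nderiv n (X k) x) \<le> 2 * d k"
      using eventually_ge_at_top[of k]
    proof eventually_elim
      case (elim m)
      then show ?case using cauchy[OF elim that, of x] d0[of m] by linarith
    qed
  qed simp
  have L_deriv: "(L n has_vector_derivative L (Suc n) x) (at x)" for n x
  proof -
    have "\<exists>g. \<forall>x\<in>UNIV. (\<lambda>k. nderiv n (X k) x) \<longlonglongrightarrow> g x \<and>
        (g has_derivative (\<lambda>h. h *\<^sub>R L (Suc n) x)) (at x within UNIV)"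
    \<comment> \<open>Termwise differentiation: by \<open>L_bd\<close> with weight exponent 0 the
      derivatives of order \<open>Suc n\<close> converge uniformly, as soon as k reaches
      \<open>Suc n\<close>.\<close>
    proof (rule has_derivative_sequence[where f' = "\<lambda>k x h. h *\<^sub>R nderiv (Suc n) (X k) x"])
      fix e :: real assume "e > 0"
      have "eventually (\<lambda>k. d k < e / 2 \<and> k \<ge> Suc n) sequentially"
        using order_tendstoD(2)[OF d_lim, of "e / 2"] \<open>e > 0\<close> eventually_ge_at_top[of "Suc n"]
        by (auto intro: eventually_conj)
      then show "\<forall>\<^sub>F k in sequentially. \<forall>x\<in>UNIV. \<forall>h.
          norm (h *\<^sub>R nderiv (Suc n) (X k) x - h *\<^sub>R L (Suc n) x) \<le> e * norm h"
      proof (rule eventually_mono, intro ballI allI)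
        fix k x and h :: real assume k: "d k < e / 2 \<and> k \<ge> Suc n"
        have "norm (nderiv (Suc n) (X k) x - L (Suc n) x) \<le> e"
          using L_bd[of 0 k "Suc n" x] k by (simp add: norm_minus_commute del: nderiv.simps)
        then show "norm (h *\<^sub>R nderiv (Suc n) (X k) x - h *\<^sub>R L (Suc n) x) \<le> e * norm h"
          by (simp add: scaleR_diff_right[symmetric] mult.commute[of e] mult_left_mono del: nderiv.simps)
      qed
    qed (use L nderiv_has_vector_derivative[OF sm] in \<open>auto simp: has_vector_derivative_def simp del: nderiv.simps\<close>)
    then obtain g where g: "\<And>x. (\<lambda>k. nderiv n (X k) x) \<longlonglongrightarrow> g x"
      "\<And>x. (g has_derivative (\<lambda>h. h *\<^sub>R L (Suc n) x)) (at x)"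
      by auto
    have "g = L n" using LIMSEQ_unique[OF g(1) L] by blast
    with g(2) show ?thesis by (simp add: has_vector_derivative_def)
  qed
  have nd: "nderiv n (L 0) = L n" and smL: "smooth_fun (L 0)" for n
    by (rule nderivI[where D = L]; (rule L_deriv | rule refl))+
  have bd: "schwartz_bound k (2 * d k) (\<lambda>x. L 0 x - X k x)" for k
    unfolding schwartz_bound_def nderiv_diff[OF smL sm] nd using L_bd by blast
  have "schwartz (L 0)"
  proof (rule schwartzI[OF smL])
    fix N
    obtain B where "schwartz_bound N B (X N)" using schwartz_bound_exists[OF X] by blast
    from schwartz_bound_add[OF smooth_fun_diff[OF smL sm] sm bd this]
    show "\<exists>B. schwartz_bound N B (L 0)" by auto
  qed
  with bd show ?thesis by (intro that)
qed

text \<open>A gliding-hump argument. If equicontinuity fails, there are arbitrarily small Schwartz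
  functions with arbitrarily large images. They are added or subtracted one after another, within
  radii so small that earlier large values survive, and the limit f violates pointwise boundedness.
  The constants in \<open>cont\<close> may depend on n, but the order M may not.\<close>

lemma schwartz_uniform_boundedness:
  fixes T :: "nat \<Rightarrow> (real \<Rightarrow> complex) \<Rightarrow> complex"
  assumes add: "\<And>n \<phi> \<psi>. schwartz \<phi> \<Longrightarrow> schwartz \<psi> \<Longrightarrow> T n (\<lambda>x. \<phi> x + \<psi> x) = T n \<phi> + T n \<psi>"
    and cmult: "\<And>n c \<phi>. schwartz \<phi> \<Longrightarrow> T n (\<lambda>x. c * \<phi> x) = c * T n \<phi>"
    and cont: "\<And>n. \<exists>C\<ge>0. \<forall>\<phi> B. schwartz \<phi> \<longrightarrow> schwartz_bound M B \<phi> \<longrightarrow> norm (T n \<phi>) \<le> C * B"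
    and ptw: "\<And>\<phi>. schwartz \<phi> \<Longrightarrow> \<exists>K. \<forall>n. norm (T n \<phi>) \<le> K"
  shows "\<exists>C\<ge>0. \<exists>N. \<forall>n \<phi> B. schwartz \<phi> \<longrightarrow> schwartz_bound N B \<phi> \<longrightarrow> norm (T n \<phi>) \<le> C * B"
proof (rule ccontr)
  assume contr: "\<not> ?thesis"
  have diff: "T n (\<lambda>x. \<phi> x - \<psi> x) = T n \<phi> - T n \<psi>" if "schwartz \<phi>" "schwartz \<psi>" for n \<phi> \<psi>
    using add[OF that(1) schwartz_cmult[OF that(2), of "-1"], of n] cmult[OF that(2), of n "-1"] by simp
  have big: "\<exists>n \<xi>. schwartz \<xi> \<and> schwartz_bound N e \<xi> \<and> norm (T n \<xi>) \<ge> K" if "e > 0" "K > 0" for N and e K :: real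
  proof -
    \<comment> \<open>Equicontinuity is refuted with the constant K / e, so that rescaling the
      counterexample to an image of norm K makes its Schwartz bound at most e.\<close>
    from contr have "\<not> (\<forall>n \<phi> B. schwartz \<phi> \<longrightarrow> schwartz_bound N B \<phi> \<longrightarrow> norm (T n \<phi>) \<le> (K / e) * B)"
      using that by (metis divide_nonneg_pos less_imp_le)
    then obtain n \<phi> B where \<phi>: "schwartz \<phi>" "schwartz_bound N B \<phi>" "norm (T n \<phi>) > (K / e) * B"
      by (auto simp: not_le)
    have "B \<ge> 0" using \<phi>(2) by (rule schwartz_bound_nonneg)
    then have "0 \<le> (K / e) * B" using that by simp
    with \<phi>(3) have pos: "norm (T n \<phi>) > 0" by linarith
    define c where "c = complex_of_real (K / norm (T n \<phi>))"
    have c: "norm c = K / norm (T n \<phi>)" using that by (simp add: c_def norm_divide)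
    have "norm c * B \<le> e"
      using \<phi>(3) pos that unfolding c by (simp add: field_simps)
    then have "schwartz_bound N e (\<lambda>x. c * \<phi> x)"
      using schwartz_bound_cmult[OF schwartz_smooth[OF \<phi>(1)] \<phi>(2), of c] by (blast intro: schwartz_bound_mono)
    moreover have "norm (T n (\<lambda>x. c * \<phi> x)) = K"
      using pos by (simp add: cmult[OF \<phi>(1)] norm_mult c)
    ultimately show ?thesis using schwartz_cmult[OF \<phi>(1)] by (metis order_refl)
  qed
  \<comment> \<open>The factor 2 in \<open>2 * e'\<close> is the loss in
    \<open>schwartz_complete\<close>, and \<open>e' \<le> e / 2\<close> is the halving it
    requires.\<close>
  have small: "\<exists>e'>0. e' \<le> e / 2 \<and> (\<forall>\<phi>. schwartz \<phi> \<longrightarrow> schwartz_bound M (2 * e') \<phi> \<longrightarrow> norm (T n \<phi>) \<le> 1)"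
    if "e > 0" for n and e :: real
  proof -
    obtain C where C: "C \<ge> 0" "\<And>\<phi> B. schwartz \<phi> \<Longrightarrow> schwartz_bound M B \<phi> \<Longrightarrow> norm (T n \<phi>) \<le> C * B"
      using cont by metis
    define e' where "e' = min (e / 2) (1 / (2 * (C + 1)))"
    have "C * (2 * e') \<le> C * (2 * (1 / (2 * (C + 1))))"
      unfolding e'_def using C(1) by (intro mult_left_mono) auto
    also have "\<dots> \<le> 1" using C(1) by (simp add: field_simps)
    finally have "C * (2 * e') \<le> 1" .
    moreover have "e' > 0" "e' \<le> e / 2" using that C(1) by (auto simp: e'_def)
    ultimately show ?thesis using C(2) by (meson order_trans)
  qed
  \<comment> \<open>A state is an index n, a function x and a radius e. \<open>P k\<close> says that
    the n-th functional has size at least k at x and moves by at most 1 within distance 2 e; Q keeps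
    the next function within e in order k.\<close>
  define P where "P = (\<lambda>k (n, x, e). schwartz x \<and> e > 0 \<and> norm (T n x) \<ge> real k \<and>
      (\<forall>\<phi>. schwartz \<phi> \<longrightarrow> schwartz_bound M (2 * e) \<phi> \<longrightarrow> norm (T n \<phi>) \<le> 1))"
  define Q where "Q = (\<lambda>k (n :: nat, x, e) (n' :: nat, x', e'). schwartz_bound k e (\<lambda>t. x' t - x t) \<and> e' \<le> e / (2::real))"
  have "\<exists>s. \<forall>k. P k (s k) \<and> Q k (s k) (s (Suc k))"
  proof (rule dependent_nat_choice)
    show "\<exists>s. P 0 s"
      using small[of 1 0] schwartz_zero by (auto simp: P_def)
  next
    fix s k assume "P k s"
    obtain n x e where s: "s = (n, x, e)" by (cases s)
    with \<open>P k s\<close> have x: "schwartz x" "e > 0" by (auto simp: P_def)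
    obtain n' \<xi> where \<xi>: "schwartz \<xi>" "schwartz_bound k e \<xi>" "norm (T n' \<xi>) \<ge> real (Suc k)"
      using big[OF x(2), of "real (Suc k)" k] by auto
    obtain e' where e': "e' > 0" "e' \<le> e / 2"
        "\<And>\<phi>. schwartz \<phi> \<Longrightarrow> schwartz_bound M (2 * e') \<phi> \<Longrightarrow> norm (T n' \<phi>) \<le> 1"
      using small[OF x(2)] by metis
    \<comment> \<open>One of the two perturbations of x is at least as large as the perturbation itself.\<close>
    have "2 * T n' \<xi> = T n' (\<lambda>t. x t + \<xi> t) - T n' (\<lambda>t. x t - \<xi> t)"
      by (simp add: add diff x \<xi>)
    then have "2 * norm (T n' \<xi>) \<le> norm (T n' (\<lambda>t. x t + \<xi> t)) + norm (T n' (\<lambda>t. x t - \<xi> t))"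
      by (metis norm_triangle_ineq4 norm_mult norm_numeral)
    then consider "norm (T n' (\<lambda>t. x t + \<xi> t)) \<ge> real (Suc k)" | "norm (T n' (\<lambda>t. x t - \<xi> t)) \<ge> real (Suc k)"
      using \<xi>(3) by linarith
    then show "\<exists>s'. P (Suc k) s' \<and> Q k s s'"
    proof cases
      case 1
      then have "P (Suc k) (n', \<lambda>t. x t + \<xi> t, e') \<and> Q k s (n', \<lambda>t. x t + \<xi> t, e')"
        using x \<xi> e' by (auto simp: P_def Q_def s schwartz_add)
      then show ?thesis by blast
    next
      case 2
      have "schwartz_bound k e (\<lambda>t. - \<xi> t)"
        using schwartz_bound_cmult[OF schwartz_smooth[OF \<xi>(1)] \<xi>(2), of "-1"] by simp
      with 2 have "P (Suc k) (n', \<lambda>t. x t - \<xi> t, e') \<and> Q k s (n', \<lambda>t. x t - \<xi> t, e')"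
        using x \<xi> e' by (auto simp: P_def Q_def s schwartz_diff)
      then show ?thesis by blast
    qed
  qed
  then obtain s where s: "\<And>k. P k (s k)" "\<And>k. Q k (s k) (s (Suc k))" by blast
  define n x e where "n = (\<lambda>k. fst (s k))" and "x = (\<lambda>k. fst (snd (s k)))" and "e = (\<lambda>k. snd (snd (s k)))"
  have P: "schwartz (x k)" "e k > 0" "norm (T (n k) (x k)) \<ge> real k"
    "\<And>\<phi>. schwartz \<phi> \<Longrightarrow> schwartz_bound M (2 * e k) \<phi> \<Longrightarrow> norm (T (n k) \<phi>) \<le> 1" for k
    using s(1)[of k] by (auto simp: P_def n_def x_def e_def split: prod.splits)
  have Q: "schwartz_bound k (e k) (\<lambda>t. x (Suc k) t - x k t)" "e (Suc k) \<le> e k / 2" for k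
    using s(2)[of k] by (auto simp: Q_def n_def x_def e_def split: prod.splits)
  obtain f where f: "schwartz f" "\<And>k. schwartz_bound k (2 * e k) (\<lambda>t. f t - x k t)"
    by (rule schwartz_complete[of x e, OF P(1,2) Q(2,1)]) blast
  obtain K where K: "\<And>n. norm (T n f) \<le> K" using ptw[OF f(1)] by blast
  \<comment> \<open>The first condition beats the pointwise bound K even after a loss of 1; the
    second lets closeness in order k imply closeness in order M.\<close>
  obtain k :: nat where k: "real k > K + 1" "k \<ge> M"
  proof -
    obtain k0 :: nat where "real k0 > K + 1" using reals_Archimedean2 by blast
    then show ?thesis by (intro that[of "max k0 M"]) (auto simp: less_max_iff_disj of_nat_max)
  qed
  have "schwartz_bound M (2 * e k) (\<lambda>t. f t - x k t)"
    using f(2)[of k] k by (blast intro: schwartz_bound_mono)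
  then have "norm (T (n k) f - T (n k) (x k)) \<le> 1"
    using P(4)[OF schwartz_diff[OF f(1) P(1)]] by (simp add: diff f P)
  then have "norm (T (n k) (x k)) \<le> norm (T (n k) f) + 1"
    by (metis add.commute add_left_mono norm_minus_commute norm_triangle_sub order_trans)
  with P(3)[of k] K[of "n k"] k(1) show False by linarith
qed

section \<open>The finite part of H(x)/x\<close>

lemma set_borel_measurable_lborel_continuous:
  fixes f :: "real \<Rightarrow> 'a::{real_normed_vector, second_countable_topology}"
  assumes "continuous_on S f" "S \<in> sets borel"
  shows "set_borel_measurable lborel S f"
  unfolding set_borel_measurable_def
  using borel_measurable_continuous_on_indicator[OF assms(2,1)] by simp

lemma pf_H_over_x_eq:
  "pf_H_over_x \<phi> = (LINT x:{0<..<1}|lborel. (\<phi> x - \<phi> 0) / complex_of_real x)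
    + (LINT x:{1<..}|lborel. \<phi> x / complex_of_real x)"
  unfolding pf_H_over_x_def interval_lebesgue_integral_def
  by (simp add: zero_ereal_def one_ereal_def)

text \<open>The dominating function for the far part, since |x \<phi>(x)| \<le> B gives |\<phi>(x) /
  x| \<le> B / x^2.\<close>

lemma inverse_square_integrable:
  shows "set_integrable lborel {1<..} (\<lambda>x::real. 1 / x\<^sup>2)" (is ?int)
    and "(LINT x:{1<..}|lborel. 1 / x\<^sup>2) = (1::real)"
proof -
  have lim: "((\<lambda>x::real. - (1 / x)) \<longlongrightarrow> 0) at_top"
    using tendsto_minus[OF tendsto_inverse_0_at_top[OF filterlim_ident]] by (simp add: divide_inverse)
  have lim1: "((\<lambda>x::real. - (1 / x)) \<longlongrightarrow> -1) (at_right 1)"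
    by (auto intro!: tendsto_eq_intros)
  note * = interval_integral_FTC_nonneg[where F = "\<lambda>x::real. - (1 / x)" and f = "\<lambda>x. 1 / x\<^sup>2"
      and a = "ereal 1" and b = \<infinity> and A = "-1" and B = 0]
  have "set_integrable lborel (einterval (ereal 1) \<infinity>) (\<lambda>x::real. 1 / x\<^sup>2) \<and>
      (LBINT x=ereal 1..\<infinity>. 1 / x\<^sup>2) = 0 - (-1 :: real)"
    by (intro conjI *)
       (use lim lim1 in \<open>auto intro!: derivative_eq_intros continuous_intros
          simp: power2_eq_square ereal_tendsto_simps\<close>)
  note * = this[THEN conjunct1] this[THEN conjunct2]
  show ?int using *(1) by simp
  show "(LINT x:{1<..}|lborel. 1 / x\<^sup>2) = (1::real)"
    using *(2) by (simp add: interval_lebesgue_integral_def)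
qed

text \<open>By the mean value inequality \<phi>(x) - \<phi>(0) is at most B x in norm, because B
  bounds the first derivative; this cancels the singularity 1/x.\<close>

lemma pf_near_integrand:
  assumes \<phi>: "schwartz \<phi>" and B: "schwartz_bound 1 B \<phi>"
  shows pf_near_bound: "x > 0 \<Longrightarrow> norm ((\<phi> x - \<phi> 0) / complex_of_real x) \<le> B"
    and pf_near_integrable: "set_integrable lborel {0<..<1} (\<lambda>x. (\<phi> x - \<phi> 0) / complex_of_real x)"
proof -
  note sm = schwartz_smooth[OF \<phi>]
  show le: "norm ((\<phi> x - \<phi> 0) / complex_of_real x) \<le> B" if "x > 0" for x
  proof -
    have "norm (\<phi> x - \<phi> 0) \<le> (\<lambda>x. B * x) x - (\<lambda>x. B * x) 0"
    proof (rule differentiable_bound_general[OF that])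
      fix y
      show "(\<phi> has_vector_derivative nderiv 1 \<phi> y) (at y)"
        using nderiv_has_vector_derivative[OF sm, of 0] by simp
      show "((\<lambda>x. B * x) has_vector_derivative B) (at y)"
        unfolding has_real_derivative_iff_has_vector_derivative[symmetric]
        by (auto intro!: derivative_eq_intros)
      show "norm (nderiv 1 \<phi> y) \<le> B"
        using schwartz_boundD[OF B, of 0 1 y] by simp
    qed (auto intro!: continuous_smooth sm continuous_intros)
    with that show ?thesis by (simp add: norm_divide field_simps)
  qed
  show "set_integrable lborel {0<..<1} (\<lambda>x. (\<phi> x - \<phi> 0) / complex_of_real x)"
  proof (rule set_integrable_bound)
    show "set_integrable lborel {0<..<1} (\<lambda>x::real. B)"
      unfolding set_integrable_def by (simp add: integrable_real_mult_indicator)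
    show "set_borel_measurable lborel {0<..<1} (\<lambda>x. (\<phi> x - \<phi> 0) / complex_of_real x)"
      by (intro set_borel_measurable_lborel_continuous continuous_intros continuous_smooth sm) auto
    show "AE x in lborel. x \<in> {0<..<1} \<longrightarrow> norm ((\<phi> x - \<phi> 0) / complex_of_real x) \<le> norm B"
      using le schwartz_bound_nonneg[OF B] by (auto intro!: AE_I2)
  qed
qed

lemma pf_far_integrand:
  assumes \<phi>: "schwartz \<phi>" and B: "schwartz_bound 1 B \<phi>"
  shows pf_far_bound: "x > 0 \<Longrightarrow> norm (\<phi> x / complex_of_real x) \<le> B * (1 / x\<^sup>2)"
    and pf_far_integrable: "set_integrable lborel {1<..} (\<lambda>x. \<phi> x / complex_of_real x)"
proof -
  note sm = schwartz_smooth[OF \<phi>]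
  show le: "norm (\<phi> x / complex_of_real x) \<le> B * (1 / x\<^sup>2)" if "x > 0" for x
    using schwartz_boundD[OF B, of 1 0 x] that by (simp add: norm_divide field_simps power2_eq_square)
  show "set_integrable lborel {1<..} (\<lambda>x. \<phi> x / complex_of_real x)"
  proof (rule set_integrable_bound)
    show "set_integrable lborel {1<..} (\<lambda>x::real. B * (1 / x\<^sup>2))"
      by (intro set_integrable_mult_right inverse_square_integrable)
    show "set_borel_measurable lborel {1<..} (\<lambda>x. \<phi> x / complex_of_real x)"
      by (intro set_borel_measurable_lborel_continuous continuous_intros continuous_smooth sm) auto
    show "AE x in lborel. x \<in> {1<..} \<longrightarrow> norm (\<phi> x / complex_of_real x) \<le> norm (B * (1 / x\<^sup>2))"
      using le schwartz_bound_nonneg[OF B] by (auto intro!: AE_I2)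
  qed
qed

lemma pf_H_over_x_add:
  assumes "schwartz \<phi>" "schwartz \<psi>"
  shows "pf_H_over_x (\<lambda>x. \<phi> x + \<psi> x) = pf_H_over_x \<phi> + pf_H_over_x \<psi>"
proof -
  obtain A B where "schwartz_bound 1 A \<phi>" "schwartz_bound 1 B \<psi>"
    using assms[THEN schwartz_bound_exists] by blast
  note int = pf_near_integrable[OF assms(1) this(1)] pf_near_integrable[OF assms(2) this(2)]
    pf_far_integrable[OF assms(1) this(1)] pf_far_integrable[OF assms(2) this(2)]
  have "(\<phi> x + \<psi> x - (\<phi> 0 + \<psi> 0)) / complex_of_real x
      = (\<phi> x - \<phi> 0) / complex_of_real x + (\<psi> x - \<psi> 0) / complex_of_real x" for x
    by (simp only: add_divide_distrib[symmetric] add_diff_add)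
  then show ?thesis
    unfolding pf_H_over_x_eq add_divide_distrib by (simp only: set_integral_add(2) int add_ac)
qed

lemma pf_H_over_x_cmult: "pf_H_over_x (\<lambda>x. c * \<phi> x) = c * pf_H_over_x \<phi>"
proof -
  have "(c * \<phi> x - c * \<phi> 0) / complex_of_real x = c * ((\<phi> x - \<phi> 0) / complex_of_real x)"
      "c * \<phi> x / complex_of_real x = c * (\<phi> x / complex_of_real x)" for x
    by (simp_all add: right_diff_distrib)
  then show ?thesis
    unfolding pf_H_over_x_eq by (simp only: set_integral_mult_right distrib_left)
qed

text \<open>Each part contributes at most B: the near interval has length 1, and 1/x^2 has integral
  1 over the far one.\<close>

lemma norm_pf_H_over_x_le:
  assumes "schwartz \<phi>" "schwartz_bound 1 B \<phi>"
  shows "norm (pf_H_over_x \<phi>) \<le> 2 * B"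
proof -
  have "norm (LINT x:{0<..<1}|lborel. (\<phi> x - \<phi> 0) / complex_of_real x)
      \<le> (LINT x:{0<..<1}|lborel. norm ((\<phi> x - \<phi> 0) / complex_of_real x))"
    by (rule set_integral_norm_bound[OF pf_near_integrable[OF assms]])
  also have "\<dots> \<le> (LINT x:{0<..<1::real}|lborel. B)"
    by (intro set_integral_mono set_integrable_norm pf_near_integrable[OF assms] pf_near_bound[OF assms])
       (auto simp: set_integrable_def integrable_real_mult_indicator)
  also have "\<dots> = B" by (simp add: set_lebesgue_integral_def)
  finally have 1: "norm (LINT x:{0<..<1}|lborel. (\<phi> x - \<phi> 0) / complex_of_real x) \<le> B" .
  have "norm (LINT x:{1<..}|lborel. \<phi> x / complex_of_real x)
      \<le> (LINT x:{1<..}|lborel. norm (\<phi> x / complex_of_real x))"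
    by (rule set_integral_norm_bound[OF pf_far_integrable[OF assms]])
  also have "\<dots> \<le> (LINT x:{1<..}|lborel. B * (1 / x\<^sup>2))"
    by (intro set_integral_mono set_integrable_norm pf_far_integrable[OF assms] pf_far_bound[OF assms]
          set_integrable_mult_right inverse_square_integrable) auto
  also have "\<dots> = B"
    by (subst set_integral_mult_right) (simp only: inverse_square_integrable mult_1_right)
  finally have "norm (LINT x:{1<..}|lborel. \<phi> x / complex_of_real x) \<le> B" .
  with 1 show ?thesis
    unfolding pf_H_over_x_eq by (intro norm_triangle_le) simp
qed

lemma pf_H_over_x_cong:
  assumes "\<And>x. x \<ge> 0 \<Longrightarrow> \<phi> x = \<psi> x"
  shows "pf_H_over_x \<phi> = pf_H_over_x \<psi>"
proof -
  have "(LINT x:{0<..<1}|lborel. (\<phi> x - \<phi> 0) / complex_of_real x)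
      = (LINT x:{0<..<1}|lborel. (\<psi> x - \<psi> 0) / complex_of_real x)"
    by (rule set_lebesgue_integral_cong) (use assms in auto)
  moreover have "(LINT x:{1<..}|lborel. \<phi> x / complex_of_real x) = (LINT x:{1<..}|lborel. \<psi> x / complex_of_real x)"
    by (rule set_lebesgue_integral_cong) (use assms in auto)
  ultimately show ?thesis unfolding pf_H_over_x_eq by simp
qed

section \<open>The finite part of H(x)/x on exponentials, via the Gamma function\<close>

lemma has_bochner_integral_powr_exp:
  fixes s t :: real
  assumes "s > 0" "t > 0"
  shows "has_bochner_integral lborel (\<lambda>x. indicator {0<..} x * (x powr (s - 1) * exp (- t * x)))
    (Gamma s * t powr (- s))"
proof -
  have "has_bochner_integral lborel (\<lambda>x. indicator {0..} x * x powr (s - 1) / exp x) (Gamma s)"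
    by (rule has_bochner_integral_nn_integral)
       (use Gamma_conv_nn_integral_real[OF assms(1)] assms(1) in \<open>auto intro!: Gamma_real_nonneg\<close>)
  \<comment> \<open>Substitute t x for x in Euler's integral. The prefactor t^(1-s) cancels against
    (t x)^(s-1), and with the Jacobian 1/t it leaves t^(-s).\<close>
  from lborel_has_bochner_integral_real_affine_iff[where t = 0, OF less_imp_neq[OF assms(2), symmetric], THEN iffD1, OF this]
  have "has_bochner_integral lborel
      (\<lambda>x. t powr (1 - s) * (indicator {0..} (0 + t * x) * (0 + t * x) powr (s - 1) / exp (0 + t * x)))
      (t powr (1 - s) * (Gamma s /\<^sub>R \<bar>t\<bar>))"
    by (intro has_bochner_integral_mult_right)
  \<comment> \<open>The indicators differ only at 0, where \<open>0 powr _\<close> is 0 and both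
    sides vanish.\<close>
  moreover have "t powr (1 - s) * (indicator {0..} (0 + t * x) * (0 + t * x) powr (s - 1) / exp (0 + t * x))
      = indicator {0<..} x * (x powr (s - 1) * exp (- t * x))" for x
  proof (cases "x > 0")
    case True
    then have "t powr (1 - s) * (t * x) powr (s - 1) = x powr (s - 1)"
      using assms by (simp add: powr_mult powr_add[symmetric] mult.assoc[symmetric])
    with True assms show ?thesis by (simp add: exp_minus field_simps)
  next
    case False
    then show ?thesis using assms by (cases "x = 0") (auto simp: indicator_def zero_le_mult_iff)
  qed
  moreover have "t powr (1 - s) * (Gamma s /\<^sub>R \<bar>t\<bar>) = Gamma s * t powr (- s)"
    using assms by (simp add: powr_diff powr_minus field_simps)
  ultimately show ?thesis by (simp only:)
qed

lemma powr_unit_interval_integral: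
  fixes s :: real
  assumes "s > 0"
  shows "set_integrable lborel {0<..<1} (\<lambda>x. x powr (s - 1))" (is ?int)
    and "(LINT x:{0<..<1}|lborel. x powr (s - 1)) = 1 / s"
proof -
  have lim: "((\<lambda>x. x powr s / s) \<longlongrightarrow> 0) (at_right 0)"
  proof -
    have "((\<lambda>x. x powr s) \<longlongrightarrow> 0) (at_right 0)"
      using assms by (intro tendsto_zero_powrI[where b = s]) (auto intro!: tendsto_intros simp: eventually_at_filter)
    from tendsto_divide[OF this tendsto_const[of s]] assms show ?thesis by simp
  qed
  have lim1: "((\<lambda>x. x powr s / s) \<longlongrightarrow> 1 / s) (at_left 1)"
    using assms by (auto intro!: tendsto_eq_intros)
  note * = interval_integral_FTC_nonneg[where F = "\<lambda>x. x powr s / s" and f = "\<lambda>x. x powr (s - 1)"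
      and a = "ereal 0" and b = "ereal 1" and A = 0 and B = "1 / s"]
  have "set_integrable lborel (einterval (ereal 0) (ereal 1)) (\<lambda>x. x powr (s - 1)) \<and>
      (LBINT x=ereal 0..ereal 1. x powr (s - 1)) = 1 / s - 0"
    by (intro conjI *)
       (use lim lim1 assms in \<open>auto intro!: derivative_eq_intros continuous_intros
          simp: ereal_tendsto_simps\<close>)
  note * = this[THEN conjunct1] this[THEN conjunct2]
  show ?int using *(1) by simp
  show "(LINT x:{0<..<1}|lborel. x powr (s - 1)) = 1 / s"
    using *(2) by (simp add: interval_lebesgue_integral_def)
qed

text \<open>The two integrals are the limit, as s tends to 0, of the Mellin transform of exp (- t x)
  with its pole 1 / s removed; the limit of the closed form involves Gamma' 1.\<close>
lemma exp_pf_integral: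
  fixes t :: real
  assumes "t > 0"
  shows "(LINT x:{0<..<1}|lborel. (exp (- t * x) - 1) / x) + (LINT x:{1<..}|lborel. exp (- t * x) / x)
    = - euler_mascheroni - ln t"
proof -
  \<comment> \<open>Both integrands carry a regularising factor x^s; the case s = 0 is the one
    wanted, as \<open>x powr 0\<close> is 1 for x > 0.\<close>
  define f where "f = (\<lambda>s x. indicator {0<..<1} x *\<^sub>R (x powr s * ((exp (- t * x) - 1) / x)))"
  define h where "h = (\<lambda>s x. indicator {1<..} x *\<^sub>R (x powr s * (exp (- t * x) / x)))"
  have meas[measurable]: "f s \<in> borel_measurable lborel" "h s \<in> borel_measurable lborel" for s
    unfolding f_def h_def by measurable
  have f_bd: "norm (f s x) \<le> indicator {0<..<1} x * t" if "s \<ge> 0" for s x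
  proof (cases "x \<in> {0<..<1}")
    case True
    have "1 - exp (- t * x) \<le> t * x" using exp_ge_add_one_self[of "- t * x"] by simp
    moreover have "exp (- t * x) \<le> 1" using True assms by simp
    ultimately have "\<bar>(exp (- t * x) - 1) / x\<bar> \<le> t"
      using True by (simp add: field_simps abs_le_iff)
    moreover have "x powr s \<le> 1" using True that by (simp add: powr_le1)
    ultimately have "\<bar>x powr s\<bar> * \<bar>(exp (- t * x) - 1) / x\<bar> \<le> 1 * t"
      by (intro mult_mono) auto
    with True show ?thesis by (simp add: f_def abs_mult)
  qed (simp add: f_def)
  \<comment> \<open>For s \<le> 1 and x > 1 the factor x^s is at most x and cancels 1/x. The trivial
    power \<open>x powr (1 - 1)\<close> is kept so that the bound matches the Gamma integrand at
    exponent 1.\<close>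
  have h_bd: "norm (h s x) \<le> indicator {0<..} x * (x powr (1 - 1) * exp (- t * x))" if "s \<le> 1" for s x
  proof (cases "x \<in> {1<..}")
    case True
    then have "x powr s \<le> x powr 1" using that by (intro powr_mono) auto
    with True have "x powr s * (exp (- t * x) / x) \<le> x * (exp (- t * x) / x)"
      by (intro mult_right_mono) auto
    with True show ?thesis by (simp add: h_def abs_mult)
  qed (simp add: h_def)
  have f_dom: "integrable lborel (\<lambda>x::real. indicator {0<..<1} x * t)"
    by (simp add: integrable_real_mult_indicator)
  have h_dom: "integrable lborel (\<lambda>x::real. indicator {0<..} x * (x powr (1 - 1) * exp (- t * x)))"
    using has_bochner_integral_powr_exp[of 1 t] assms by (simp only: has_bochner_integral_iff zero_less_one)
  define S where "S = (\<lambda>n. inverse (real (Suc n)))"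
  have S: "S n > 0" "S n \<le> 1" for n by (auto simp: S_def field_simps)
  have S_lim: "S \<longlonglongrightarrow> 0" unfolding S_def by (rule LIMSEQ_inverse_real_of_nat)
  have f_int: "integrable lborel (f (S n))" for n
    by (rule Bochner_Integration.integrable_bound[OF f_dom])
       (use order_trans[OF f_bd abs_ge_self] S[of n] in \<open>auto intro!: AE_I2\<close>)
  have h_int: "integrable lborel (h (S n))" for n
    by (rule Bochner_Integration.integrable_bound[OF h_dom])
       (use order_trans[OF h_bd abs_ge_self] S[of n] in \<open>auto intro!: AE_I2\<close>)
  have powr_lim: "(\<lambda>n. x powr S n) \<longlonglongrightarrow> x powr 0" if "x > 0" for x
    using that by (intro tendsto_powr tendsto_const S_lim) auto
  have "(\<lambda>n. integral\<^sup>L lborel (f (S n))) \<longlonglongrightarrow> integral\<^sup>L lborel (f 0)"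
  proof (rule integral_dominated_convergence[OF _ _ f_dom])
    show "AE x in lborel. (\<lambda>n. f (S n) x) \<longlonglongrightarrow> f 0 x"
    proof (rule AE_I2)
      fix x show "(\<lambda>n. f (S n) x) \<longlonglongrightarrow> f 0 x"
      proof (cases "x > 0")
        case True
        then show ?thesis unfolding f_def by (intro tendsto_scaleR tendsto_mult tendsto_const powr_lim)
      qed (simp add: f_def)
    qed
    show "AE x in lborel. norm (f (S n) x) \<le> indicator {0<..<1} x * t" for n
      using f_bd[of "S n"] S[of n] by auto
  qed measurable
  moreover have "(\<lambda>n. integral\<^sup>L lborel (h (S n))) \<longlonglongrightarrow> integral\<^sup>L lborel (h 0)"
  proof (rule integral_dominated_convergence[OF _ _ h_dom])
    show "AE x in lborel. (\<lambda>n. h (S n) x) \<longlonglongrightarrow> h 0 x"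
    proof (rule AE_I2)
      fix x show "(\<lambda>n. h (S n) x) \<longlonglongrightarrow> h 0 x"
      proof (cases "x > 0")
        case True
        then show ?thesis unfolding h_def by (intro tendsto_scaleR tendsto_mult tendsto_const powr_lim)
      qed (simp add: h_def)
    qed
    show "AE x in lborel. norm (h (S n) x) \<le> indicator {0<..} x * (x powr (1 - 1) * exp (- t * x))" for n
      using h_bd[of "S n"] S[of n] by auto
  qed measurable
  ultimately have lim1: "(\<lambda>n. integral\<^sup>L lborel (f (S n)) + integral\<^sup>L lborel (h (S n)))
      \<longlonglongrightarrow> integral\<^sup>L lborel (f 0) + integral\<^sup>L lborel (h 0)"
    by (rule tendsto_add)
  \<comment> \<open>For s > 0 the subtracted constant can be integrated separately: it contributes
    the integral 1/s of x^(s-1) over the unit interval, and adding that back completes the Mellin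
    transform.\<close>
  have eq: "integral\<^sup>L lborel (f s) + integral\<^sup>L lborel (h s) = Gamma s * t powr (- s) - 1 / s"
    if s: "s > 0" and int: "integrable lborel (f s)" "integrable lborel (h s)" for s
  proof -
    let ?p = "\<lambda>x::real. indicator {0<..<1} x *\<^sub>R x powr (s - 1)"
    have p: "integrable lborel ?p" "integral\<^sup>L lborel ?p = 1 / s"
      using powr_unit_interval_integral[OF s] by (simp_all add: set_integrable_def set_lebesgue_integral_def)
    have "Gamma s * t powr (- s) = (\<integral>x. indicator {0<..} x * (x powr (s - 1) * exp (- t * x)) \<partial>lborel)"
      using has_bochner_integral_powr_exp[OF s assms] by (simp add: has_bochner_integral_iff)
    also have "\<dots> = (\<integral>x. ?p x + (f s x + h s x) \<partial>lborel)"
    proof (rule integral_cong_AE)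
      \<comment> \<open>The point 1 lies in neither open interval and has to be discarded as a null
        set.\<close>
      show "AE x in lborel. indicator {0<..} x * (x powr (s - 1) * exp (- t * x)) = ?p x + (f s x + h s x)"
        using AE_lborel_singleton[of 1]
      proof eventually_elim
        case (elim x)
        then show ?case
          by (auto simp: f_def h_def indicator_def powr_diff field_simps)
      qed
    qed measurable
    also have "\<dots> = 1 / s + (integral\<^sup>L lborel (f s) + integral\<^sup>L lborel (h s))"
      using p int by simp
    finally show ?thesis by simp
  qed
  have lim2: "(\<lambda>n. Gamma (S n) * t powr (- S n) - 1 / S n) \<longlonglongrightarrow> - euler_mascheroni - ln t"
  proof -
    \<comment> \<open>Since Gamma(s) = Gamma(1+s) / s, the closed form is the difference quotient at
      0 of Gamma(1+s) t^(-s). Its derivative there is Gamma'(1) - ln t, with Gamma'(1) =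
      -\<gamma>.\<close>
    have "((\<lambda>s. Gamma (1 + s) * t powr (- s)) has_real_derivative
        (Gamma 1 * Digamma 1) * t powr 0 + Gamma 1 * (- ln t * t powr 0)) (at 0)"
      using assms by (auto intro!: derivative_eq_intros)
    then have "((\<lambda>s. (Gamma (1 + s) * t powr (- s) - 1) / s) \<longlongrightarrow> - euler_mascheroni - ln t) (at 0)"
      using assms by (simp add: has_field_derivative_iff)
    moreover have "filterlim S (at 0) sequentially"
      unfolding filterlim_at using S(1) S_lim by (auto intro!: always_eventually simp: less_imp_neq[symmetric])
    ultimately have "(\<lambda>n. (Gamma (1 + S n) * t powr (- S n) - 1) / S n) \<longlonglongrightarrow> - euler_mascheroni - ln t"
      by (rule filterlim_compose)
    moreover have "(Gamma (1 + S n) * t powr (- S n) - 1) / S n = Gamma (S n) * t powr (- S n) - 1 / S n" for n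
    proof -
      have "S n \<notin> \<int>\<^sub>\<le>\<^sub>0" using S[of n] by (auto elim!: nonpos_Ints_cases)
      then have "Gamma (1 + S n) = S n * Gamma (S n)" using Gamma_plus1[of "S n"] by (simp add: add.commute)
      then show ?thesis using S[of n] by (simp add: field_simps)
    qed
    ultimately show ?thesis by simp
  qed
  have "integral\<^sup>L lborel (f 0) + integral\<^sup>L lborel (h 0) = - euler_mascheroni - ln t"
    using LIMSEQ_unique[OF lim1] lim2 by (simp add: eq S f_int h_int)
  moreover have "integral\<^sup>L lborel (f 0) = (LINT x:{0<..<1}|lborel. (exp (- t * x) - 1) / x)"
    unfolding set_lebesgue_integral_def f_def by (intro Bochner_Integration.integral_cong) (auto simp: indicator_def)
  moreover have "integral\<^sup>L lborel (h 0) = (LINT x:{1<..}|lborel. exp (- t * x) / x)"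
    unfolding set_lebesgue_integral_def h_def by (intro Bochner_Integration.integral_cong) (auto simp: indicator_def)
  ultimately show ?thesis by simp
qed

lemma pf_H_over_x_exp:
  assumes "t > 0"
  shows "pf_H_over_x (\<lambda>x. complex_of_real (exp (- t * x))) = of_real (- euler_mascheroni - ln t)"
proof -
  have "pf_H_over_x (\<lambda>x. complex_of_real (exp (- t * x)))
      = (LINT x:{0<..<1}|lborel. complex_of_real ((exp (- t * x) - 1) / x))
        + (LINT x:{1<..}|lborel. complex_of_real (exp (- t * x) / x))"
    unfolding pf_H_over_x_eq by simp
  also have "\<dots> = of_real (- euler_mascheroni - ln t)"
    unfolding set_integral_complex_of_real exp_pf_integral[OF assms, symmetric] by simp
  finally show ?thesis .
qed

section \<open>Density of exponentials\<close>

lemma smooth_fun_sum: "finite I \<Longrightarrow> (\<And>i. i \<in> I \<Longrightarrow> smooth_fun (f i)) \<Longrightarrow> smooth_fun (\<lambda>x. \<Sum>i\<in>I. f i x)"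
  by (induction I rule: finite_induct) (auto intro: smooth_fun_const smooth_fun_add)

lemma nderiv_sum:
  "finite I \<Longrightarrow> (\<And>i. i \<in> I \<Longrightarrow> smooth_fun (f i)) \<Longrightarrow>
    nderiv n (\<lambda>x. \<Sum>i\<in>I. f i x) = (\<lambda>x. \<Sum>i\<in>I. nderiv n (f i) x)"
  by (induction I rule: finite_induct) (auto simp: nderiv_const nderiv_add smooth_fun_sum)

text \<open>On [-1, \<infinity>) the function 1 - exp(-\<delta> x) and all its derivatives are
  O(\<delta> (1 + |x|)). The extra factor |x| is paid for by one more weight on \<phi>, which is why
  its bound is taken in order \<open>Suc N\<close>.\<close>

lemma schwartz_damping_bound:
  assumes "schwartz \<phi>"
  obtains C where "C \<ge> 0"
    "\<And>\<delta> j k x. 0 < \<delta> \<Longrightarrow> \<delta> \<le> 1 \<Longrightarrow> j \<le> N \<Longrightarrow> k \<le> N \<Longrightarrow> x \<ge> -1 \<Longrightarrow>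
      \<bar>x\<bar> ^ j * norm (nderiv k (\<lambda>x. \<phi> x - \<phi> x * complex_of_real (exp (- \<delta> * x))) x) \<le> C * \<delta>"
proof -
  note sm = schwartz_smooth[OF assms]
  obtain B where B: "schwartz_bound (Suc N) B \<phi>" using schwartz_bound_exists[OF assms] by blast
  have B0: "B \<ge> 0" by (rule schwartz_bound_nonneg[OF B])
  show ?thesis
  \<comment> \<open>2^N comes from Leibniz' formula, and 6 = 3 * 2: the 3 bounds exp(-\<delta> x)
    for \<delta> \<le> 1 and x \<ge> -1, the 2 counts the weights |x|^j and |x|^(j+1).\<close>
  proof (rule that[of "2 ^ N * (6 * B)"])
    fix \<delta> x :: real and j k
    assume \<delta>: "0 < \<delta>" "\<delta> \<le> 1" and jk: "j \<le> N" "k \<le> N" and x: "x \<ge> -1"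
    define h where "h = (\<lambda>x. 1 - complex_of_real (exp (- \<delta> * x)))"
    have h: "smooth_fun h"
      unfolding h_def by (intro smooth_fun_diff smooth_fun_const smooth_fun_exp)
    have exp3: "exp (- \<delta> * x) \<le> 3"
    proof -
      have "- \<delta> * x \<le> \<delta> * 1" using \<delta> x mult_left_mono[of "-x" 1 \<delta>] by simp
      then have "exp (- \<delta> * x) \<le> exp 1" using \<delta> by simp
      then show ?thesis using exp_le by linarith
    qed
    have h_bd: "norm (nderiv m h x) \<le> 3 * \<delta> * (1 + \<bar>x\<bar>)" for m
    proof (cases m)
      case 0
      have "\<bar>1 - exp (- \<delta> * x)\<bar> \<le> 3 * \<delta> * \<bar>x\<bar>"
      proof (cases "x \<ge> 0")
        case True
        then have "exp (- \<delta> * x) \<le> 1" "1 - exp (- \<delta> * x) \<le> \<delta> * x" "0 \<le> \<delta> * x"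
          using \<delta> exp_ge_add_one_self[of "- \<delta> * x"] by auto
        then show ?thesis using True by (simp add: mult.assoc)
      next
        case False
        define v where "v = - \<delta> * x"
        have v: "v > 0" "exp v \<le> 3" using False \<delta> exp3 by (auto simp: v_def mult_pos_neg)
        have "1 - v \<le> exp (- v)" using exp_ge_add_one_self[of "- v"] by simp
        then have "(1 - v) * exp v \<le> exp (- v) * exp v" by (intro mult_right_mono) auto
        then have "exp v - 1 \<le> v * exp v" by (simp add: algebra_simps flip: exp_add)
        also have "\<dots> \<le> v * 3" using v by (intro mult_left_mono) auto
        finally have "exp v - 1 \<le> v * 3" .
        moreover have "exp v \<ge> 1" using v by simp
        ultimately have "\<bar>1 - exp v\<bar> \<le> 3 * v" by simp
        then show ?thesis using False by (simp add: v_def mult.assoc)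
      qed
      also have "\<dots> \<le> 3 * \<delta> * (1 + \<bar>x\<bar>)" using \<delta> by (simp add: algebra_simps)
      finally have "norm (complex_of_real (1 - exp (- \<delta> * x))) \<le> 3 * \<delta> * (1 + \<bar>x\<bar>)"
        unfolding norm_of_real .
      then show ?thesis using 0 by (simp add: h_def)
    next
      case (Suc l)
      have "norm (nderiv m h x) = \<delta> ^ m * exp (- \<delta> * x)"
        unfolding h_def nderiv_diff[OF smooth_fun_const smooth_fun_exp] nderiv_exp nderiv_const
        using Suc \<delta> by (simp add: norm_mult norm_power)
      also have "\<dots> \<le> \<delta> * 3"
        using exp3 \<delta> Suc by (intro mult_mono) (auto simp: mult_le_cancel_left2 power_le_one)
      also have "\<dots> \<le> 3 * \<delta> * (1 + \<bar>x\<bar>)" using \<delta> by (simp add: algebra_simps)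
      finally show ?thesis .
    qed
    have "\<bar>x\<bar> ^ j * norm (nderiv k (\<lambda>x. \<phi> x * h x) x) \<le> 2 ^ k * (6 * B * \<delta>)"
    proof (rule nderiv_mult_weighted_bound[OF sm h])
      fix i m assume im: "i \<le> k" "m \<le> k"
      have "\<bar>x\<bar> ^ j * (norm (nderiv i \<phi> x) * norm (nderiv m h x))
          \<le> \<bar>x\<bar> ^ j * (norm (nderiv i \<phi> x) * (3 * \<delta> * (1 + \<bar>x\<bar>)))"
        by (intro mult_left_mono h_bd) auto
      also have "\<dots> = 3 * \<delta> * (\<bar>x\<bar> ^ j * norm (nderiv i \<phi> x) + \<bar>x\<bar> ^ Suc j * norm (nderiv i \<phi> x))"
        by (simp add: algebra_simps)
      also have "\<dots> \<le> 3 * \<delta> * (B + B)"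
        using \<delta> im jk by (intro mult_left_mono add_mono schwartz_boundD[OF B]) auto
      finally show "\<bar>x\<bar> ^ j * (norm (nderiv i \<phi> x) * norm (nderiv m h x)) \<le> 6 * B * \<delta>"
        by (simp add: mult_ac)
    qed simp
    also have "\<dots> \<le> 2 ^ N * (6 * B * \<delta>)"
      using B0 \<delta> jk by (intro mult_right_mono power_increasing) auto
    finally show "\<bar>x\<bar> ^ j * norm (nderiv k (\<lambda>x. \<phi> x - \<phi> x * complex_of_real (exp (- \<delta> * x))) x)
        \<le> 2 ^ N * (6 * B) * \<delta>"
      by (simp add: h_def right_diff_distrib mult_ac)
  qed (use B0 in simp)
qed

text \<open>The mean value inequality compares f on [x, y] with the primitive -(A/r) exp(-r z) of
  the bound on its derivative; then y tends to infinity. Each such integration costs a factor 1/r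
  and keeps the rate r.\<close>

lemma exp_decay_of_deriv_exp_decay:
  fixes f :: "real \<Rightarrow> complex"
  assumes der: "\<And>x. (f has_vector_derivative f' x) (at x)" and "r > 0"
    and le: "\<And>x. x \<ge> c \<Longrightarrow> norm (f' x) \<le> A * exp (- r * x)"
    and lim: "(f \<longlongrightarrow> 0) at_top" and "x \<ge> c"
  shows "norm (f x) \<le> A / r * exp (- r * x)"
proof -
  have bd: "norm (f y - f x) \<le> A / r * exp (- r * x) - A / r * exp (- r * y)" if "y > x" for y
  proof -
    have "norm (f y - f x) \<le> (\<lambda>z. - (A / r * exp (- r * z))) y - (\<lambda>z. - (A / r * exp (- r * z))) x"
    proof (rule differentiable_bound_general[OF that])
      show "continuous_on {x..y} f"
        using der by (auto intro: continuous_at_imp_continuous_on has_vector_derivative_continuous)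
      fix z assume "x < z" "z < y"
      show "(f has_vector_derivative f' z) (at z)" by (rule der)
      show "((\<lambda>z. - (A / r * exp (- r * z))) has_vector_derivative A * exp (- r * z)) (at z)"
        unfolding has_real_derivative_iff_has_vector_derivative[symmetric]
        using \<open>r > 0\<close> by (auto intro!: derivative_eq_intros)
      show "norm (f' z) \<le> A * exp (- r * z)" using \<open>x < z\<close> \<open>x \<ge> c\<close> by (intro le) simp
    qed (use \<open>r > 0\<close> in \<open>auto intro!: continuous_intros\<close>)
    then show ?thesis by simp
  qed
  have "((\<lambda>y. A / r * exp (- r * x) - A / r * exp (- r * y)) \<longlongrightarrow> A / r * exp (- r * x) - A / r * 0) at_top"
  proof (intro tendsto_intros)
    have "filterlim (\<lambda>y. - r * y) at_bot at_top"
      using \<open>r > 0\<close> by (intro filterlim_tendsto_neg_mult_at_bot[OF tendsto_const]) (auto simp: filterlim_ident)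
    then show "((\<lambda>y. exp (- r * y)) \<longlongrightarrow> 0) at_top" by (rule filterlim_compose[OF exp_at_bot])
  qed
  moreover have "((\<lambda>y. norm (f y - f x)) \<longlongrightarrow> norm (0 - f x)) at_top"
    by (intro tendsto_intros lim)
  moreover have "eventually (\<lambda>y. norm (f y - f x) \<le> A / r * exp (- r * x) - A / r * exp (- r * y)) at_top"
    using eventually_gt_at_top[of x] by eventually_elim (rule bd)
  ultimately have "norm (0 - f x) \<le> A / r * exp (- r * x) - A / r * 0"
    by (intro tendsto_le[OF trivial_limit_at_top_linorder])
  then show ?thesis by simp
qed

text \<open>Real and imaginary parts are approximated to within e/2 each; padding with zero
  coefficients merges the two polynomials into one of common degree.\<close>

lemma Weierstrass_complex:
  fixes w :: "real \<Rightarrow> complex"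
  assumes "compact S" "continuous_on S w" "e > 0"
  obtains a n where "\<And>s. s \<in> S \<Longrightarrow> norm (w s - (\<Sum>i\<le>n::nat. a i * of_real (s ^ i))) \<le> e"
proof -
  have "\<exists>a n. \<forall>s\<in>S. \<bar>v s - (\<Sum>i\<le>n::nat. a i * s ^ i)\<bar> < e / 2" if v: "continuous_on S v" for v :: "real \<Rightarrow> real"
  proof -
    obtain p where p: "real_polynomial_function p" "\<And>x. x \<in> S \<Longrightarrow> \<bar>v x - p x\<bar> < e / 2"
      using Stone_Weierstrass_real_polynomial_function[OF assms(1) v, of "e / 2"] assms(3) by auto
    then show ?thesis using real_polynomial_function_iff_sum by auto
  qed
  from this[OF continuous_on_Re[OF assms(2)]] this[OF continuous_on_Im[OF assms(2)]]
  obtain a m b n where ab: "\<And>s. s \<in> S \<Longrightarrow> \<bar>Re (w s) - (\<Sum>i\<le>m::nat. a i * s ^ i)\<bar> < e / 2"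
      "\<And>s. s \<in> S \<Longrightarrow> \<bar>Im (w s) - (\<Sum>i\<le>n::nat. b i * s ^ i)\<bar> < e / 2"
    by blast
  let ?N = "max m n"
  define c where "c = (\<lambda>i. Complex (if i \<le> m then a i else 0) (if i \<le> n then b i else 0))"
  have pad: "(\<Sum>i\<le>?N. (if i \<le> k then a i else 0) * s ^ i) = (\<Sum>i\<le>k. a i * s ^ i)" if "k \<le> ?N" for k s and a :: "nat \<Rightarrow> real"
    by (rule sum.mono_neutral_cong_right) (use that in auto)
  show ?thesis
  proof (rule that[of c ?N])
    fix s assume s: "s \<in> S"
    let ?d = "w s - (\<Sum>i\<le>?N. c i * of_real (s ^ i))"
    have "Re ?d = Re (w s) - (\<Sum>i\<le>m. a i * s ^ i)" "Im ?d = Im (w s) - (\<Sum>i\<le>n. b i * s ^ i)"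
      using pad[of m a s] pad[of n b s] by (simp_all add: c_def Re_sum Im_sum del: of_real_power)
    with ab[OF s] have "\<bar>Re ?d\<bar> + \<bar>Im ?d\<bar> \<le> e" by linarith
    with cmod_le[of ?d] show "norm ?d \<le> e" by linarith
  qed
qed

lemma schwartz_exponential_approximation:
  assumes \<phi>: "schwartz \<phi>" and "\<epsilon> > 0"
  obtains r :: real and a :: "nat \<Rightarrow> complex" and n :: nat where "r > 0"
    "\<And>j k x. j \<le> N \<Longrightarrow> k \<le> N \<Longrightarrow> x \<ge> -1 \<Longrightarrow> \<bar>x\<bar> ^ j *
      norm (nderiv k (\<lambda>x. \<phi> x - (\<Sum>i\<le>n. a i * complex_of_real (exp (- (real (Suc i) * r) * x)))) x) \<le> \<epsilon>"
proof -
  note sm = schwartz_smooth[OF \<phi>]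
  obtain C where C: "C \<ge> 0"
    "\<And>\<delta> j k x. 0 < \<delta> \<Longrightarrow> \<delta> \<le> 1 \<Longrightarrow> j \<le> N \<Longrightarrow> k \<le> N \<Longrightarrow> x \<ge> -1 \<Longrightarrow>
      \<bar>x\<bar> ^ j * norm (nderiv k (\<lambda>x. \<phi> x - \<phi> x * complex_of_real (exp (- \<delta> * x))) x) \<le> C * \<delta>"
    by (rule schwartz_damping_bound[OF \<phi>, of N]) blast
  define \<delta> where "\<delta> = min 1 (\<epsilon> / (2 * (C + 1)))"
  have \<delta>: "0 < \<delta>" "\<delta> \<le> 1" using C(1) \<open>\<epsilon> > 0\<close> by (auto simp: \<delta>_def)
  have C\<delta>: "C * \<delta> \<le> \<epsilon> / 2"
  proof -
    have "C * \<delta> \<le> C * (\<epsilon> / (2 * (C + 1)))" unfolding \<delta>_def using C(1) by (intro mult_left_mono) auto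
    also have "\<dots> \<le> \<epsilon> / 2" using C(1) \<open>\<epsilon> > 0\<close> by (simp add: field_simps)
    finally show ?thesis .
  qed
  \<comment> \<open>Half the damping rate makes exp(-\<delta> x) the square of the variable s =
    exp(-r x).\<close>
  define r where "r = \<delta> / 2"
  have r: "r > 0" "\<delta> = 2 * r" using \<delta> by (simp_all add: r_def)
  define u where "u = (\<lambda>x. \<phi> x * complex_of_real (exp (- \<delta> * x)))"
  have u: "smooth_fun u" unfolding u_def by (intro smooth_fun_mult sm smooth_fun_exp)
  obtain B where B: "schwartz_bound N B \<phi>" using schwartz_bound_exists[OF \<phi>] by blast
  have B0: "B \<ge> 0" by (rule schwartz_bound_nonneg[OF B])
  have u_bd: "norm (nderiv k u x) \<le> 2 ^ k * (B * exp (- \<delta> * x))" if "k \<le> N" for k x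
  proof -
    have "1 * norm (nderiv k u x) \<le> 2 ^ k * (B * exp (- \<delta> * x))"
      unfolding u_def
    proof (rule nderiv_mult_weighted_bound[OF sm smooth_fun_exp])
      fix i m assume "i \<le> k" "m \<le> k"
      have "norm (nderiv i \<phi> x) \<le> B"
        using schwartz_boundD[OF B, of 0 i x] \<open>i \<le> k\<close> that by simp
      moreover have "norm (nderiv m (\<lambda>x. complex_of_real (exp (- \<delta> * x))) x) \<le> exp (- \<delta> * x)"
        unfolding nderiv_exp norm_of_real abs_mult using \<delta> by (simp add: power_abs power_le_one)
      ultimately show "1 * (norm (nderiv i \<phi> x) * norm (nderiv m (\<lambda>x. complex_of_real (exp (- \<delta> * x))) x))
          \<le> B * exp (- \<delta> * x)"
        using B0 by (simp only: mult_1_left) (intro mult_mono, auto)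
    qed simp
    then show ?thesis by simp
  qed
  have exp_lim: "((\<lambda>x. exp (- t * x)) \<longlongrightarrow> 0) at_top" if "t > 0" for t :: real
    using that by (intro filterlim_compose[OF exp_at_bot] filterlim_tendsto_neg_mult_at_bot[OF tendsto_const])
      (auto simp: filterlim_ident)

  obtain K where K: "K \<ge> 0" "\<And>j x. j \<le> N \<Longrightarrow> x \<ge> -1 \<Longrightarrow> \<bar>x\<bar> ^ j * exp (- r * x) \<le> K"
    by (rule power_exp_bounded[OF r(1), of N "-1"]) blast
  \<comment> \<open>R dominates the factor (1/r)^(N-k) from integrating down from order N to order
    k, and K bounds the weights against exp(-r x). The tolerance e below is chosen so that e R K is
    at most \<epsilon>/2.\<close>
  define R where "R = max 1 (1 / r) ^ N"
  have R: "R \<ge> 0" by (simp add: R_def)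
  define e where "e = \<epsilon> / (2 * (R * K + 1))"
  have RK: "R * K \<ge> 0" using R K(1) by simp
  then have e: "e > 0" using \<open>\<epsilon> > 0\<close> by (simp add: e_def)
  have eRK: "e * R * K \<le> \<epsilon> / 2"
    using RK \<open>\<epsilon> > 0\<close> unfolding e_def by (simp add: field_simps)

  \<comment> \<open>In the variable s = exp (- r x) the quotient of the N-th derivative by s extends continuously to s = 0.\<close>
  define w where "w = (\<lambda>s. if s = 0 then 0 else of_real (1 / s) * nderiv N u (- ln s / r))"
  have w_bd: "norm (w s) \<le> 2 ^ N * B * \<bar>s\<bar>" if "s \<ge> 0" for s
  proof (cases "s = 0")
    case False
    with that have s: "s > 0" by simp
    \<comment> \<open>At x = -ln s / r the damping equals s^2. After the division by s one factor s
      remains, which forces w to tend to 0 at s = 0.\<close>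
    have "exp (- \<delta> * (- ln s / r)) = exp (ln s + ln s)" using r by simp
    also have "\<dots> = s * s" using s by (simp only: exp_add exp_ln)
    finally have "norm (nderiv N u (- ln s / r)) \<le> 2 ^ N * (B * (s * s))"
      using u_bd[OF order_refl, of "- ln s / r"] by (simp only:)
    then show ?thesis using s by (simp add: w_def norm_mult norm_divide field_simps)
  qed (simp add: w_def)
  \<comment> \<open>As x runs over [-1, \<infinity>), s runs over (0, exp r]; adjoining 0, the image
    of infinity, makes the domain compact.\<close>
  have "continuous_on {0..exp r} w"
    unfolding continuous_on_eq_continuous_within
  proof
    fix s assume "s \<in> {0..exp r}"
    then consider "s = 0" | "s > 0" by force
    then show "continuous (at s within {0..exp r}) w"
    proof cases
      case 1
      have "(w \<longlongrightarrow> 0) (at 0 within {0..exp r})"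
      proof (rule Lim_null_comparison)
        show "\<forall>\<^sub>F s in at 0 within {0..exp r}. norm (w s) \<le> 2 ^ N * B * \<bar>s\<bar>"
          using w_bd by (auto simp: eventually_at_filter)
        show "((\<lambda>s. 2 ^ N * B * \<bar>s\<bar>) \<longlongrightarrow> 0) (at 0 within {0..exp r})"
          by (auto intro!: tendsto_eq_intros)
      qed
      then show ?thesis using 1 by (simp add: continuous_within w_def)
    next
      case 2
      have "continuous_on {0<..} (\<lambda>s. - ln s / r)"
        using r by (intro continuous_intros) auto
      from continuous_on_compose2[OF continuous_nderiv[OF u] this subset_UNIV]
      have "continuous_on {0<..} (\<lambda>s. of_real (1 / s) * nderiv N u (- ln s / r))"
        by (rule continuous_on_mult[rotated]) (auto intro!: continuous_intros)
      also have "?this \<longleftrightarrow> continuous_on {0<..} w"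
        by (rule continuous_on_cong) (auto simp: w_def)
      finally have "isCont w s"
        by (rule continuous_on_interior) (use 2 in \<open>simp add: interior_open\<close>)
      then show ?thesis by (rule continuous_at_imp_continuous_at_within)
    qed
  qed
  then obtain a n where a: "\<And>s. s \<in> {0..exp r} \<Longrightarrow> norm (w s - (\<Sum>i\<le>n::nat. a i * of_real (s ^ i))) \<le> e"
    by (rule Weierstrass_complex[OF compact_Icc _ e]) blast
  define \<tau> where "\<tau> = (\<lambda>i. real (Suc i) * r)"
  have \<tau>: "\<tau> i > 0" for i using r by (simp add: \<tau>_def)
  \<comment> \<open>Differentiating exp(-\<tau> x) N times produces (-\<tau>)^N. Dividing by it
    makes the N-th derivative of \<psi> equal to s times the Weierstrass polynomial; the division is
    legitimate because every exponent is positive.\<close>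
  define a' where "a' = (\<lambda>i. a i / of_real ((- \<tau> i) ^ N))"
  define \<psi> where "\<psi> = (\<lambda>x. \<Sum>i\<le>n. a' i * complex_of_real (exp (- \<tau> i * x)))"
  have \<psi>: "smooth_fun \<psi>" unfolding \<psi>_def by (intro smooth_fun_sum smooth_fun_cmult smooth_fun_exp) auto
  have nderiv_\<psi>: "nderiv k \<psi> x = (\<Sum>i\<le>n. a' i * of_real ((- \<tau> i) ^ k * exp (- \<tau> i * x)))" for k x
    unfolding \<psi>_def nderiv_sum[OF finite_atMost smooth_fun_cmult[OF smooth_fun_exp]]
      nderiv_cmult[OF smooth_fun_exp] nderiv_exp ..
  define v where "v = (\<lambda>x. u x - \<psi> x)"
  have v: "smooth_fun v" unfolding v_def by (intro smooth_fun_diff u \<psi>)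
  have nderiv_v: "nderiv k v x = nderiv k u x - nderiv k \<psi> x" for k x
    unfolding v_def by (simp add: nderiv_diff u \<psi>)
  \<comment> \<open>Vanishing at infinity fixes the constant of integration in each of the N
    integrations below.\<close>
  have v_lim: "(nderiv k v \<longlongrightarrow> 0) at_top" if "k \<le> N" for k
  proof -
    have "(nderiv k u \<longlongrightarrow> 0) at_top"
    proof (rule Lim_null_comparison)
      show "((\<lambda>x. 2 ^ k * (B * exp (- \<delta> * x))) \<longlongrightarrow> 0) at_top"
        using exp_lim[OF \<delta>(1)] by (intro tendsto_mult_right_zero)
    qed (use u_bd[OF that] in auto)
    moreover have "((\<lambda>x. \<Sum>i\<le>n. a' i * of_real ((- \<tau> i) ^ k * exp (- \<tau> i * x))) \<longlongrightarrow>
        (\<Sum>i\<le>n. a' i * of_real ((- \<tau> i) ^ k * 0))) at_top"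
      by (intro tendsto_intros exp_lim \<tau>)
    then have "(nderiv k \<psi> \<longlongrightarrow> 0) at_top" by (simp add: nderiv_\<psi>[abs_def])
    ultimately have "((\<lambda>x. nderiv k u x - nderiv k \<psi> x) \<longlongrightarrow> 0 - 0) at_top" by (rule tendsto_diff)
    then show ?thesis by (simp add: nderiv_v[abs_def])
  qed
  have v_N: "norm (nderiv N v x) \<le> e * exp (- r * x)" if "x \<ge> -1" for x
  proof -
    define s where "s = exp (- r * x)"
    have s: "s > 0" "s \<le> exp r" "- ln s / r = x"
      using r that mult_left_mono[of "- x" 1 r] by (simp_all add: s_def)
    have "nderiv N \<psi> x = (\<Sum>i\<le>n. a i * of_real (s * s ^ i))"
      unfolding nderiv_\<psi>
    proof (rule sum.cong)
      fix i
      have "exp (- \<tau> i * x) = s ^ Suc i"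
        unfolding s_def exp_of_nat_mult[symmetric] by (simp add: \<tau>_def mult_ac)
      then show "a' i * of_real ((- \<tau> i) ^ N * exp (- \<tau> i * x)) = a i * of_real (s * s ^ i)"
        using \<tau>[of i] by (simp add: a'_def)
    qed simp
    also have "\<dots> = of_real s * (\<Sum>i\<le>n. a i * of_real (s ^ i))"
      by (simp add: sum_distrib_left mult_ac)
    finally have "nderiv N \<psi> x = of_real s * (\<Sum>i\<le>n. a i * of_real (s ^ i))" .
    moreover have "nderiv N u x = of_real s * w s" using s by (simp add: w_def)
    ultimately have "nderiv N v x = of_real s * (w s - (\<Sum>i\<le>n. a i * of_real (s ^ i)))"
      by (simp add: nderiv_v right_diff_distrib)
    then have "norm (nderiv N v x) = s * norm (w s - (\<Sum>i\<le>n. a i * of_real (s ^ i)))"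
      using s by (simp add: norm_mult)
    also have "\<dots> \<le> s * e" using s by (intro mult_left_mono a) auto
    finally show ?thesis by (simp add: s_def mult.commute)
  qed
  \<comment> \<open>Downward induction on the order of the derivative: m counts the integrations
    already made.\<close>
  have v_k: "norm (nderiv (N - m) v x) \<le> e * (1 / r) ^ m * exp (- r * x)" if "m \<le> N" "x \<ge> -1" for m x
    using that
  proof (induction m arbitrary: x)
    case 0
    then show ?case using v_N by simp
  next
    case (Suc m)
    have "norm (nderiv (N - Suc m) v x) \<le> e * (1 / r) ^ m / r * exp (- r * x)"
    proof (rule exp_decay_of_deriv_exp_decay[where c = "-1"])
      fix x
      show "(nderiv (N - Suc m) v has_vector_derivative nderiv (N - m) v x) (at x)"
        using nderiv_has_vector_derivative[OF v, of "N - Suc m" x] Suc.prems by (simp add: Suc_diff_Suc)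
    qed (use Suc r v_lim in auto)
    then show ?case by (simp add: mult_ac)
  qed
  show ?thesis
  proof (rule that[OF r(1), of a' n])
    fix j k x assume jk: "j \<le> N" "k \<le> N" and x: "x \<ge> (-1::real)"
    have "norm (nderiv k v x) \<le> e * (1 / r) ^ (N - k) * exp (- r * x)"
      using v_k[of "N - k" x] jk x by simp
    also have "\<dots> \<le> e * R * exp (- r * x)"
    proof -
      have "(1 / r) ^ (N - k) \<le> R"
        unfolding R_def using r
        by (intro order_trans[OF power_mono[of "1 / r" "max 1 (1 / r)"] power_increasing]) auto
      then show ?thesis using e by (intro mult_right_mono mult_left_mono) auto
    qed
    finally have "\<bar>x\<bar> ^ j * norm (nderiv k v x) \<le> \<bar>x\<bar> ^ j * (e * R * exp (- r * x))"
      by (intro mult_left_mono) auto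
    also have "\<dots> = e * R * (\<bar>x\<bar> ^ j * exp (- r * x))" by (simp add: mult_ac)
    also have "\<dots> \<le> e * R * K" using jk x e R by (intro mult_left_mono K) auto
    also have "\<dots> \<le> \<epsilon> / 2" by (rule eRK)
    finally have 1: "\<bar>x\<bar> ^ j * norm (nderiv k v x) \<le> \<epsilon> / 2" .
    have 2: "\<bar>x\<bar> ^ j * norm (nderiv k (\<lambda>x. \<phi> x - u x) x) \<le> \<epsilon> / 2"
      using C(2)[OF \<delta> jk x] C\<delta> unfolding u_def by linarith
    have "(\<lambda>x. \<phi> x - (\<Sum>i\<le>n. a' i * complex_of_real (exp (- (real (Suc i) * r) * x))))
        = (\<lambda>x. (\<phi> x - u x) + v x)"
      by (simp add: v_def \<psi>_def \<tau>_def)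
    then have "nderiv k (\<lambda>x. \<phi> x - (\<Sum>i\<le>n. a' i * complex_of_real (exp (- (real (Suc i) * r) * x)))) x
        = nderiv k (\<lambda>x. \<phi> x - u x) x + nderiv k v x"
      by (simp only: nderiv_add[OF smooth_fun_diff[OF sm u] v])
    moreover have "\<bar>x\<bar> ^ j * norm (nderiv k (\<lambda>x. \<phi> x - u x) x + nderiv k v x)
        \<le> \<bar>x\<bar> ^ j * (norm (nderiv k (\<lambda>x. \<phi> x - u x) x) + norm (nderiv k v x))"
      by (intro mult_left_mono norm_triangle_ineq) auto
    ultimately show "\<bar>x\<bar> ^ j * norm (nderiv k (\<lambda>x. \<phi> x -
        (\<Sum>i\<le>n. a' i * complex_of_real (exp (- (real (Suc i) * r) * x)))) x) \<le> \<epsilon>"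
      using 1 2 by (simp only: distrib_left)
  qed
qed

section \<open>The Tauberian theorem\<close>

text \<open>Equicontinuity together with convergence on a dense set gives convergence everywhere.
  \<open>local\<close> replaces density in the whole Schwartz space by density on [-1, \<infinity>)
  after multiplication by the cutoff.\<close>

lemma schwartz_family_tendsto_0:
  fixes T :: "real \<Rightarrow> (real \<Rightarrow> complex) \<Rightarrow> complex"
  assumes add: "\<And>l \<phi> \<psi>. l \<ge> 1 \<Longrightarrow> schwartz \<phi> \<Longrightarrow> schwartz \<psi> \<Longrightarrow> T l (\<lambda>x. \<phi> x + \<psi> x) = T l \<phi> + T l \<psi>"
    and cmult: "\<And>l c \<phi>. l \<ge> 1 \<Longrightarrow> schwartz \<phi> \<Longrightarrow> T l (\<lambda>x. c * \<phi> x) = c * T l \<phi>"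
    and cont: "\<And>l. l \<ge> 1 \<Longrightarrow> \<exists>C\<ge>0. \<forall>\<phi> B. schwartz \<phi> \<longrightarrow> schwartz_bound M B \<phi> \<longrightarrow> norm (T l \<phi>) \<le> C * B"
    and bdd: "\<And>\<phi>. schwartz \<phi> \<Longrightarrow> \<exists>K. eventually (\<lambda>l. norm (T l \<phi>) \<le> K) at_top"
    and \<eta>: "cutoff \<eta>" "\<And>x. x \<le> -1 \<Longrightarrow> \<eta> x = 0"
    and local: "\<And>l \<phi>. l \<ge> 1 \<Longrightarrow> schwartz \<phi> \<Longrightarrow> T l \<phi> = T l (\<lambda>x. \<eta> x * \<phi> x)"
    and exp: "\<And>t. t > 0 \<Longrightarrow> ((\<lambda>l. T l (\<lambda>x. \<eta> x * complex_of_real (exp (- t * x)))) \<longlongrightarrow> 0) at_top"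
    and \<phi>: "schwartz \<phi>"
  shows "((\<lambda>l. T l \<phi>) \<longlongrightarrow> 0) at_top"
proof (rule tendsto_at_topI_sequentially)
  fix X :: "nat \<Rightarrow> real" assume X: "filterlim X at_top sequentially"
  \<comment> \<open>The hypotheses hold only for l \<ge> 1. Truncating from below enforces this for
    every index and changes only finitely many terms.\<close>
  define Y where "Y = (\<lambda>n. max 1 (X n))"
  have Y1: "Y n \<ge> 1" for n by (simp add: Y_def)
  have Y: "filterlim Y at_top sequentially"
    by (rule filterlim_at_top_mono[OF X]) (simp add: Y_def)
  have "\<exists>C\<ge>0. \<exists>N. \<forall>n \<phi> B. schwartz \<phi> \<longrightarrow> schwartz_bound N B \<phi> \<longrightarrow> norm (T (Y n) \<phi>) \<le> C * B"
  proof (rule schwartz_uniform_boundedness[where M = M])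
    fix \<phi> assume "schwartz \<phi>"
    then obtain K where "eventually (\<lambda>l. norm (T l \<phi>) \<le> K) at_top" using bdd by blast
    then have "eventually (\<lambda>n. norm (T (Y n) \<phi>) \<le> K) sequentially"
      using Y by (rule eventually_compose_filterlim)
    then have "Bseq (\<lambda>n. T (Y n) \<phi>)" by (rule BfunI)
    then show "\<exists>K. \<forall>n. norm (T (Y n) \<phi>) \<le> K" by (auto simp: Bseq_def)
  qed (use add cmult cont Y1 in auto)
  then obtain C N where C: "C \<ge> 0"
      "\<And>n \<phi> B. schwartz \<phi> \<Longrightarrow> schwartz_bound N B \<phi> \<Longrightarrow> norm (T (Y n) \<phi>) \<le> C * B"
    by blast
  obtain K where K: "K \<ge> 0"
    "\<And>f B. smooth_fun f \<Longrightarrow> (\<And>j k x. j \<le> N \<Longrightarrow> k \<le> N \<Longrightarrow> x \<ge> -1 \<Longrightarrow> \<bar>x\<bar> ^ j * norm (nderiv k f x) \<le> B) \<Longrightarrow>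
      schwartz_bound N (K * B) (\<lambda>x. \<eta> x * f x)"
    by (rule cutoff_mult_bound[OF \<eta>, of "-1" N]) auto
  have "(\<lambda>n. T (Y n) \<phi>) \<longlonglongrightarrow> 0"
  proof (rule LIMSEQ_I)
    fix e :: real assume "e > 0"
    \<comment> \<open>C is the equicontinuity constant and K the cost of the cutoff, so this
      tolerance makes the approximation error at most e/2 uniformly along the sequence; adding 1
      avoids division by 0.\<close>
    define e' where "e' = e / (2 * (C * K + 1))"
    have CK: "C * K \<ge> 0" using C K by simp
    have e': "e' > 0" using CK \<open>e > 0\<close> by (simp add: e'_def)
    have CKe: "C * (K * e') \<le> e / 2" using CK \<open>e > 0\<close> by (simp add: e'_def field_simps)
    obtain r :: real and a n where r: "r > 0" and appr:
      "\<And>j k x. j \<le> N \<Longrightarrow> k \<le> N \<Longrightarrow> x \<ge> -1 \<Longrightarrow> \<bar>x\<bar> ^ j *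
        norm (nderiv k (\<lambda>x. \<phi> x - (\<Sum>i\<le>n. a i * complex_of_real (exp (- (real (Suc i) * r) * x)))) x) \<le> e'"
      by (rule schwartz_exponential_approximation[OF \<phi> e', of N]) blast
    define E where "E = (\<lambda>i x. \<eta> x * complex_of_real (exp (- (real (Suc i) * r) * x)))"
    define \<psi> where "\<psi> = (\<lambda>x. \<Sum>i\<le>n. a i * complex_of_real (exp (- (real (Suc i) * r) * x)))"
    have pos: "real (Suc i) * r > 0" for i using r by simp
    have E: "schwartz (E i)" for i
      unfolding E_def by (rule schwartz_cutoff_exp[OF \<eta>(1) pos])
    have sum_E: "schwartz (\<lambda>x. \<Sum>i\<le>m. a i * E i x)
        \<and> T (Y k) (\<lambda>x. \<Sum>i\<le>m. a i * E i x) = (\<Sum>i\<le>m. a i * T (Y k) (E i))" for k m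
      by (induction m) (auto simp: schwartz_add schwartz_cmult E add cmult Y1)
    have \<eta>\<psi>: "(\<lambda>x. \<eta> x * \<psi> x) = (\<lambda>x. \<Sum>i\<le>n. a i * E i x)"
      by (simp add: \<psi>_def E_def sum_distrib_left mult_ac)
    have "smooth_fun (\<lambda>x. \<phi> x - \<psi> x)"
      unfolding \<psi>_def
      by (intro smooth_fun_diff schwartz_smooth[OF \<phi>] smooth_fun_sum smooth_fun_cmult smooth_fun_exp) auto
    then have bd: "schwartz_bound N (K * e') (\<lambda>x. \<eta> x * (\<phi> x - \<psi> x))"
      using appr unfolding \<psi>_def by (rule K(2))
    have eq: "(\<lambda>x. \<eta> x * (\<phi> x - \<psi> x)) = (\<lambda>x. \<eta> x * \<phi> x - (\<Sum>i\<le>n. a i * E i x))"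
      using \<eta>\<psi> by (simp add: fun_eq_iff right_diff_distrib)
    have sch: "schwartz (\<lambda>x. \<eta> x * (\<phi> x - \<psi> x))"
      unfolding eq using sum_E by (intro schwartz_diff schwartz_cutoff_mult_schwartz \<eta> \<phi>) auto
    \<comment> \<open>The localised error term is small uniformly in k, and what remains is a fixed
      finite combination of cut-off exponentials, so k can go to infinity with the approximation
      frozen.\<close>
    have "T (Y k) \<phi> = T (Y k) (\<lambda>x. \<eta> x * (\<phi> x - \<psi> x)) + (\<Sum>i\<le>n. a i * T (Y k) (E i))" for k
    proof -
      have "T (Y k) \<phi> = T (Y k) (\<lambda>x. \<eta> x * (\<phi> x - \<psi> x) + (\<Sum>i\<le>n. a i * E i x))"
        unfolding local[OF Y1 \<phi>] by (simp add: fun_cong[OF eq])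
      also have "\<dots> = T (Y k) (\<lambda>x. \<eta> x * (\<phi> x - \<psi> x)) + (\<Sum>i\<le>n. a i * T (Y k) (E i))"
        using add[OF Y1 sch, of "\<lambda>x. \<Sum>i\<le>n. a i * E i x"] sum_E by simp
      finally show ?thesis .
    qed
    moreover have "norm (T (Y k) (\<lambda>x. \<eta> x * (\<phi> x - \<psi> x))) \<le> e / 2" for k
      using C(2)[OF sch bd, of k] CKe by linarith
    ultimately have le: "norm (T (Y k) \<phi>) \<le> e / 2 + norm (\<Sum>i\<le>n. a i * T (Y k) (E i))" for k
      by (simp only: order_trans[OF norm_triangle_ineq add_right_mono])
    have "(\<lambda>k. \<Sum>i\<le>n. a i * T (Y k) (E i)) \<longlonglongrightarrow> (\<Sum>i\<le>n. a i * 0)"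
    proof (intro tendsto_intros)
      fix i
      show "(\<lambda>k. T (Y k) (E i)) \<longlonglongrightarrow> 0"
        unfolding E_def by (rule filterlim_compose[OF exp[OF pos] Y])
    qed
    then have "(\<lambda>k. \<Sum>i\<le>n. a i * T (Y k) (E i)) \<longlonglongrightarrow> 0" by simp
    from LIMSEQ_D[OF this, of "e / 2"] \<open>e > 0\<close>
    obtain k0 where "\<And>k. k \<ge> k0 \<Longrightarrow> norm (\<Sum>i\<le>n. a i * T (Y k) (E i)) < e / 2" by auto
    then have "norm (T (Y k) \<phi>) < e" if "k \<ge> k0" for k
      using le[of k] that by force
    then show "\<exists>k0. \<forall>k\<ge>k0. norm (T (Y k) \<phi> - 0) < e" by auto
  qed
  moreover have "eventually (\<lambda>n. T (Y n) \<phi> = T (X n) \<phi>) sequentially"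
    using filterlim_at_top[THEN iffD1, OF X, rule_format, of 1]
    by eventually_elim (simp add: Y_def max_def)
  ultimately show "(\<lambda>n. T (X n) \<phi>) \<longlonglongrightarrow> 0" by (rule Lim_transform_eventually)
qed

section \<open>Localisation of g and its Laplace transform\<close>

context
  fixes g :: "(real \<Rightarrow> complex) \<Rightarrow> complex"
  assumes g: "tempered g"
begin

lemma tempered_add: "schwartz \<phi> \<Longrightarrow> schwartz \<psi> \<Longrightarrow> g (\<lambda>x. \<phi> x + \<psi> x) = g \<phi> + g \<psi>"
  using g by (simp add: tempered_def)

lemma tempered_cmult: "schwartz \<phi> \<Longrightarrow> g (\<lambda>x. c * \<phi> x) = c * g \<phi>"
  using g by (simp add: tempered_def)

lemma tempered_diff:
  assumes "schwartz \<phi>" "schwartz \<psi>" shows "g (\<lambda>x. \<phi> x - \<psi> x) = g \<phi> - g \<psi>"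
  using tempered_add[OF assms(1) schwartz_cmult[OF assms(2), of "-1"]] tempered_cmult[OF assms(2), of "-1"] by simp

context
  assumes supp: "supported_nonneg g"
begin

text \<open>The margin e keeps the closure of the nonzero set away from 0; a function that vanishes
  merely on [0, \<infinity>) may have 0 in its support.\<close>

lemma supported_nonneg_eq_0:
  assumes "schwartz \<phi>" "e > 0" "\<And>x. x \<ge> - e \<Longrightarrow> \<phi> x = 0"
  shows "g \<phi> = 0"
proof -
  have "{x. \<phi> x \<noteq> 0} \<subseteq> {..- e}" using assms(3) linear by blast
  then have "closure {x. \<phi> x \<noteq> 0} \<subseteq> {..- e}" by (intro closure_minimal) auto
  then have "closure {x. \<phi> x \<noteq> 0} \<inter> {0..} = {}" using assms(2) by fastforce
  with supp assms(1) show ?thesis by (simp add: supported_nonneg_def)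
qed

text \<open>The description in \<open>laplace\<close> is well defined because two cutoffs agree on a
  neighbourhood of [0, \<infinity>), so g does not see their difference.\<close>

lemma laplace_eq:
  assumes "cutoff \<eta>" "y > 0"
  shows "laplace g y = g (\<lambda>x. \<eta> x * complex_of_real (exp (- y * x)))"
  unfolding laplace_def
proof (rule the_equality)
  show "\<forall>\<eta>'. cutoff \<eta>' \<longrightarrow> g (\<lambda>x. \<eta>' x * complex_of_real (exp (- y * x)))
      = g (\<lambda>x. \<eta> x * complex_of_real (exp (- y * x)))"
  proof (intro allI impI)
    fix \<eta>' assume \<eta>': "cutoff \<eta>'"
    let ?e = "\<lambda>\<eta> x. \<eta> x * complex_of_real (exp (- y * x))"
    note sch = schwartz_cutoff_exp[OF \<eta>' assms(2)] schwartz_cutoff_exp[OF assms]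
    obtain e1 e2 where e: "e1 > 0" "\<And>x. x \<ge> - e1 \<Longrightarrow> \<eta> x = 1" "e2 > 0" "\<And>x. x \<ge> - e2 \<Longrightarrow> \<eta>' x = 1"
      using assms(1) \<eta>' unfolding cutoff_def by blast
    have "g (\<lambda>x. ?e \<eta>' x - ?e \<eta> x) = 0"
      by (rule supported_nonneg_eq_0[OF schwartz_diff[OF sch], of "min e1 e2"]) (use e in auto)
    then show "g (?e \<eta>') = g (?e \<eta>)" using tempered_diff[OF sch] by simp
  qed
qed (use assms(1) in blast)

end
end

text \<open>Dilating the test function \<eta>(x) exp(-t x) also dilates the cutoff. Since the result
  is again a cutoff, the pairing with g is the Laplace transform at t/l.\<close>

lemma cutoff_dilate:
  assumes "cutoff \<eta>" "l \<ge> 1"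
  shows "cutoff (\<lambda>x. \<eta> (x / l))"
proof -
  obtain e c where e: "e > 0" "\<And>x. x \<ge> - e \<Longrightarrow> \<eta> x = 1" and c: "\<And>x. x \<le> c \<Longrightarrow> \<eta> x = 0"
    using assms(1) unfolding cutoff_def by blast
  have "\<eta> (x / l) = 1" if "x \<ge> - e" for x
  proof (rule e(2))
    have "- e * l \<le> - e * 1" using e(1) assms(2) by (intro mult_left_mono_neg) auto
    with that assms(2) show "x / l \<ge> - e" by (simp add: field_simps)
  qed
  moreover have "\<eta> (x / l) = 0" if "x \<le> c * l" for x
    by (rule c) (use that assms(2) in \<open>simp add: field_simps\<close>)
  ultimately show ?thesis
    unfolding cutoff_def using e(1) smooth_fun_dilate[OF cutoff_smooth[OF assms(1)]] by blast
qed

theorem theorem3p5: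
  fixes g :: "(real \<Rightarrow> complex) \<Rightarrow> complex" and a b :: complex
  assumes "tempered g"
    and "supported_nonneg g"
    and "((\<lambda>y. laplace g y - (a + b * complex_of_real (ln (1 / y)))) \<longlongrightarrow> 0) (at_right 0)"
    and "\<And>\<phi>. schwartz \<phi> \<Longrightarrow>
           (\<lambda>l. dilate g l \<phi> - b * complex_of_real (ln l) * \<phi> 0 / complex_of_real l)
             \<in> O[at_top](\<lambda>l. complex_of_real (1 / l))"
  shows "\<And>\<phi>. schwartz \<phi> \<Longrightarrow>
           (\<lambda>l. dilate g l \<phi>
                 - ((a + b * euler_mascheroni) * \<phi> 0 / complex_of_real l
                    + b * complex_of_real (ln l / l) * \<phi> 0
                    + b / complex_of_real l * pf_H_over_x \<phi>))
             \<in> o[at_top](\<lambda>l. complex_of_real (1 / l))"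
proof -
  note g = assms(1,2)
  obtain \<eta> where \<eta>: "cutoff \<eta>" "\<And>x. x \<le> -1 \<Longrightarrow> \<eta> x = 0" "\<And>x. x \<ge> -1/2 \<Longrightarrow> \<eta> x = 1"
    by (rule cutoff_exists) blast
  define T where "T = (\<lambda>l \<phi>. g (\<lambda>x. \<phi> (x / l)) - b * of_real (ln l) * \<phi> 0
      - (a + b * euler_mascheroni) * \<phi> 0 - b * pf_H_over_x \<phi>)"
  have T_add: "T l (\<lambda>x. \<phi> x + \<psi> x) = T l \<phi> + T l \<psi>" if "l \<ge> 1" "schwartz \<phi>" "schwartz \<psi>" for l \<phi> \<psi>
    using that by (simp add: T_def tempered_add[OF g(1)] schwartz_dilate pf_H_over_x_add algebra_simps)
  have T_cmult: "T l (\<lambda>x. c * \<phi> x) = c * T l \<phi>" if "l \<ge> 1" "schwartz \<phi>" for l c \<phi>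
    using that by (simp add: T_def tempered_cmult[OF g(1)] schwartz_dilate pf_H_over_x_cmult algebra_simps)
  obtain C N where C: "C \<ge> 0" "\<And>\<phi> B. schwartz \<phi> \<Longrightarrow> schwartz_bound N B \<phi> \<Longrightarrow> norm (g \<phi>) \<le> C * B"
    by (rule tempered_bound[OF g(1)]) blast
  have T_cont: "\<exists>C\<ge>0. \<forall>\<phi> B. schwartz \<phi> \<longrightarrow> schwartz_bound (max N 1) B \<phi> \<longrightarrow> norm (T l \<phi>) \<le> C * B"
    if l: "l \<ge> 1" for l
  proof (intro exI conjI allI impI)
    \<comment> \<open>This constant grows with l, which is allowed: only the order of the bound has
      to be common to all l. Uniformity comes later from the Tauberian hypothesis.\<close>
    let ?C = "C * l ^ N + norm (b * of_real (ln l)) + norm (a + b * euler_mascheroni) + norm b * 2"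
    show "?C \<ge> 0" using C(1) l by simp
    fix \<phi> B assume \<phi>: "schwartz \<phi>" and B: "schwartz_bound (max N 1) B \<phi>"
    have "schwartz_bound N B \<phi>" "schwartz_bound 1 B \<phi>" using B by (auto intro: schwartz_bound_mono)
    then have "norm (g (\<lambda>x. \<phi> (x / l))) \<le> C * (l ^ N * B)" "norm (pf_H_over_x \<phi>) \<le> 2 * B" "norm (\<phi> 0) \<le> B"
      using C(2)[OF schwartz_dilate[OF \<phi> l] schwartz_bound_dilate[OF schwartz_smooth[OF \<phi>] _ l]]
        norm_pf_H_over_x_le[OF \<phi>] schwartz_bound_norm by blast+
    then have "norm (T l \<phi>) \<le> C * (l ^ N * B) + norm (b * of_real (ln l)) * B
        + norm (a + b * euler_mascheroni) * B + norm b * (2 * B)"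
      unfolding T_def
      by (intro order_trans[OF norm_triangle_ineq4] add_mono)
         (auto simp: norm_mult intro!: mult_left_mono)
    then show "norm (T l \<phi>) \<le> ?C * B" by (simp add: algebra_simps)
  qed
  have T_dilate: "T l \<phi> = of_real l * (dilate g l \<phi> - b * complex_of_real (ln l) * \<phi> 0 / complex_of_real l)
      - ((a + b * euler_mascheroni) * \<phi> 0 + b * pf_H_over_x \<phi>)" if "l \<ge> 1" for l \<phi>
    using that by (simp add: T_def dilate_def field_simps)
  have T_bdd: "\<exists>K. eventually (\<lambda>l. norm (T l \<phi>) \<le> K) at_top" if \<phi>: "schwartz \<phi>" for \<phi>
  proof -
    let ?c = "norm ((a + b * euler_mascheroni) * \<phi> 0 + b * pf_H_over_x \<phi>)"
    obtain K where "eventually (\<lambda>l. norm (dilate g l \<phi> - b * complex_of_real (ln l) * \<phi> 0 / complex_of_real l)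
        \<le> K * norm (complex_of_real (1 / l))) at_top"
      using assms(4)[OF \<phi>] by (elim landau_o.bigE)
    \<comment> \<open>The Tauberian hypothesis controls the part of T that contains g, once
      multiplied by l; the remaining terms do not depend on l.\<close>
    then have "eventually (\<lambda>l. norm (T l \<phi>) \<le> K + ?c) at_top"
      using eventually_ge_at_top[of 1]
    proof eventually_elim
      case (elim l)
      have "norm (of_real l * (dilate g l \<phi> - b * complex_of_real (ln l) * \<phi> 0 / complex_of_real l))
          \<le> l * (K * norm (complex_of_real (1 / l)))"
        using elim unfolding norm_mult by (intro mult_mono) auto
      also have "\<dots> = K" using elim by (simp add: norm_divide)
      finally show ?case
        unfolding T_dilate[OF elim(2)] by (intro order_trans[OF norm_triangle_ineq4] add_right_mono)
    qed
    then show ?thesis by blast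
  qed
  have T_local: "T l \<phi> = T l (\<lambda>x. \<eta> x * \<phi> x)" if l: "l \<ge> 1" and \<phi>: "schwartz \<phi>" for l \<phi>
  proof -
    note \<eta>\<phi> = schwartz_cutoff_mult_schwartz[OF \<eta>(1) \<phi>]
    have "g (\<lambda>x. \<phi> (x / l) - \<eta> (x / l) * \<phi> (x / l)) = 0"
    \<comment> \<open>For l \<ge> 1 dilation can only widen the region where the cutoff is 1, so the
      margin 1/2 serves every l.\<close>
    proof (rule supported_nonneg_eq_0[OF g, of _ "1/2"])
      fix x :: real assume "x \<ge> - (1/2)"
      then have "x / l \<ge> -1/2" using l by (simp add: field_simps)
      then show "\<phi> (x / l) - \<eta> (x / l) * \<phi> (x / l) = 0" using \<eta>(3) by simp
    qed (use schwartz_diff schwartz_dilate[OF \<phi> l] schwartz_dilate[OF \<eta>\<phi> l] in auto)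
    then have "g (\<lambda>x. \<phi> (x / l)) = g (\<lambda>x. \<eta> (x / l) * \<phi> (x / l))"
      using tempered_diff[OF g(1) schwartz_dilate[OF \<phi> l] schwartz_dilate[OF \<eta>\<phi> l]] by simp
    moreover have "pf_H_over_x \<phi> = pf_H_over_x (\<lambda>x. \<eta> x * \<phi> x)"
      by (rule pf_H_over_x_cong) (simp add: \<eta>(3))
    ultimately show ?thesis by (simp add: T_def \<eta>(3))
  qed
  have T_exp: "((\<lambda>l. T l (\<lambda>x. \<eta> x * complex_of_real (exp (- t * x)))) \<longlongrightarrow> 0) at_top" if t: "t > 0" for t
  proof -
    have "filterlim (\<lambda>l. t / l) (at_right 0) at_top"
      unfolding filterlim_at
    proof
      show "eventually (\<lambda>l. t / l \<in> {0<..} \<and> t / l \<noteq> 0) at_top"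
        using eventually_gt_at_top[of 0] by eventually_elim (use t in auto)
      show "((\<lambda>l. t / l) \<longlongrightarrow> 0) at_top"
        by (intro tendsto_divide_0[OF tendsto_const] filterlim_at_top_imp_at_infinity filterlim_ident)
    qed
    from filterlim_compose[OF assms(3) this]
    have "((\<lambda>l. laplace g (t / l) - (a + b * complex_of_real (ln (1 / (t / l))))) \<longlongrightarrow> 0) at_top" .
    \<comment> \<open>With y = t/l the remainder in the Laplace asymptotics is exactly T on the
      cut-off exponential: ln(1/y) = ln l - ln t, and the terms b ln t and b \<gamma> cancel against
      the finite part and the coefficient of \<delta>.\<close>
    moreover have "eventually (\<lambda>l. laplace g (t / l) - (a + b * complex_of_real (ln (1 / (t / l))))
        = T l (\<lambda>x. \<eta> x * complex_of_real (exp (- t * x)))) at_top"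
      using eventually_ge_at_top[of 1]
    proof eventually_elim
      case (elim l)
      have lap: "laplace g (t / l) = g (\<lambda>x. \<eta> (x / l) * complex_of_real (exp (- t * (x / l))))"
        using laplace_eq[OF g cutoff_dilate[OF \<eta>(1) elim], of "t / l"] t elim by simp
      have ln: "ln (1 / (t / l)) = ln l - ln t" using t elim by (simp add: ln_div)
      have "pf_H_over_x (\<lambda>x. \<eta> x * complex_of_real (exp (- t * x)))
          = pf_H_over_x (\<lambda>x. complex_of_real (exp (- t * x)))"
        by (rule pf_H_over_x_cong) (simp add: \<eta>(3))
      also have "\<dots> = - euler_mascheroni - complex_of_real (ln t)"
        unfolding pf_H_over_x_exp[OF t] by simp
      finally have pf: "pf_H_over_x (\<lambda>x. \<eta> x * complex_of_real (exp (- t * x)))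
          = - euler_mascheroni - complex_of_real (ln t)" .
      show ?case
        unfolding T_def lap ln pf using \<eta>(3)[of 0] by (simp add: algebra_simps)
    qed
    ultimately show ?thesis by (rule Lim_transform_eventually)
  qed
  fix \<phi> assume \<phi>: "schwartz \<phi>"
  have lim: "((\<lambda>l. T l \<phi>) \<longlongrightarrow> 0) at_top"
    by (rule schwartz_family_tendsto_0[OF T_add T_cmult T_cont T_bdd \<eta>(1,2) T_local T_exp \<phi>])
  show "(\<lambda>l. dilate g l \<phi>
                 - ((a + b * euler_mascheroni) * \<phi> 0 / complex_of_real l
                    + b * complex_of_real (ln l / l) * \<phi> 0
                    + b / complex_of_real l * pf_H_over_x \<phi>))
             \<in> o[at_top](\<lambda>l. complex_of_real (1 / l))" (is "?f \<in> _")
  proof (rule smalloI_tendsto)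
    have "eventually (\<lambda>l. T l \<phi> = ?f l / complex_of_real (1 / l)) at_top"
      using eventually_ge_at_top[of 1]
      by eventually_elim (simp add: T_dilate field_simps)
    with lim show "((\<lambda>l. ?f l / complex_of_real (1 / l)) \<longlongrightarrow> 0) at_top"
      by (rule Lim_transform_eventually)
    show "eventually (\<lambda>l. complex_of_real (1 / l) \<noteq> 0) at_top"
      using eventually_gt_at_top[of 0] by eventually_elim simp
  qed
qed

end
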